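(* Let $X$ be a set, $H$ a complex Hilbert space, $\mathfrak{A}$ a $C^{*}$-algebra with unit $1_{\mathfrak{A}}$, and let $K\colon X\times X\to \mathcal{B}(\mathfrak{A},\mathcal{B}(H))$ be a function. Then $K$ satisfies $$\sum_{i,j=1}^{N}\left\langle u_{i},K(s_{i},s_{j})(a_{i}^{*}a_{j})u_{j}\right\rangle _{H}\geq 0$$ for all $N\in\mathbb{N}$, $(u_i)_{i=1}^N\subset H$, $(s_i)_{i=1}^N\subset X$, $(a_i)_{i=1}^N\subset\mathfrak{A}$, if and only if there exist a Hilbert space $\mathscr{L}$, a representation $\pi\colon\mathfrak{A}\to \mathcal{B}(\mathscr{L})$ of $\mathfrak{A}$, and operators $V(t)\colon H\to\mathscr{L}$, $t\in X$, such that $$K(s,t)(a)=V(s)^{*}\pi(a)V(t)\qquad\text{for all } s,t\in X,\ a\in\mathfrak{A}.$$ Moreover, if in such a factorization $\mathscr{L}$ is minimal, i.e. $$\mathscr{L}=\overline{\mathrm{span}}\left\{\pi(a)V(t)u : a\in\mathfrak{A},\ t\in X,\ u\in H\right\},$$ then $\mathscr{L}\simeq H_{\tilde{K}}$ (unitarily isomorphic), and so $\mathscr{L}$ is unique up to unitary equivalence.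
   Context: Inner products are linear in the second variable. $\mathcal{B}(H)$ denotes the bounded linear operators on $H$, and $\mathcal{B}(\mathfrak{A},\mathcal{B}(H))$ the bounded linear maps from $\mathfrak{A}$ to $\mathcal{B}(H)$. "Operator" means bounded linear operator, and "representation" means $*$-representation (a $*$-homomorphism into $\mathcal{B}(\mathscr{L})$). For $K$ satisfying the displayed positivity condition, put $\Omega=X\times\mathfrak{A}\times H$ and define the scalar-valued positive definite kernel $\tilde{K}\colon\Omega\times\Omega\to\mathbb{C}$ by $$\tilde{K}\left((s,a,u),(t,b,v)\right)=\left\langle u,K(s,t)(a^{*}b)v\right\rangle_{H}.$$ $H_{\tilde{K}}$ is the reproducing kernel Hilbert space of functions on $\Omega$ with kernel $\tilde{K}$; it is the closed linear span of the functions $\tilde{K}_{(t,b,v)}=\tilde{K}(\cdot,(t,b,v))$, $(t,b,v)\in\Omega$, with $\langle\tilde{K}_{x},\tilde{K}_{y}\rangle_{H_{\tilde{K}}}=\tilde{K}(x,y)$ for $x,y\in\Omega$. *)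

theory Defs
  imports
    "HOL-Analysis.Analysis"
    "HOL-Library.Complex_Order"
    "HOL-Library.Function_Algebras"
begin

section \<open>Complex vector spaces\<close>

class complex_vector = ab_group_add +
  fixes scaleC :: "complex \<Rightarrow> 'a \<Rightarrow> 'a"  (infixr \<open>*\<^sub>C\<close> 75)
  assumes scaleC_add_right: "c *\<^sub>C (x + y) = c *\<^sub>C x + c *\<^sub>C y"
    and scaleC_add_left: "(c + d) *\<^sub>C x = c *\<^sub>C x + d *\<^sub>C x"
    and scaleC_scaleC: "c *\<^sub>C d *\<^sub>C x = (c * d) *\<^sub>C x"
    and scaleC_one: "1 *\<^sub>C x = x"

global_interpretation complex_vector?: vector_space "scaleC :: complex \<Rightarrow> 'a \<Rightarrow> 'a :: complex_vector"
  defines csubspace_raw_def: csubspace = complex_vector.subspace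
    and cspan_raw_def: cspan = complex_vector.span
  by unfold_locales (simp_all add: scaleC_add_right scaleC_add_left scaleC_scaleC scaleC_one)

instantiation complex :: complex_vector
begin

definition scaleC_complex_def [simp]: "scaleC c (z :: complex) = c * z"

instance
  by standard (simp_all add: algebra_simps)

end

instantiation "fun" :: (type, complex_vector) complex_vector
begin

definition scaleC_fun_def: "scaleC c f = (\<lambda>x. c *\<^sub>C f x)"

instance
  by standard
    (simp_all add: scaleC_fun_def fun_eq_iff scaleC_add_right scaleC_add_left scaleC_scaleC scaleC_one)

end

section \<open>Unital C*-algebras\<close>

text \<open>
  The class \<^class>\<open>monoid_mult\<close> is used instead of \<^class>\<open>real_normed_algebra_1\<close> so that the zero
  algebra, in which the unit is zero, is not excluded.
\<close>

class cstar_algebra = complex_vector + real_normed_algebra + banach + monoid_mult +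
  fixes star :: "'a \<Rightarrow> 'a"
  assumes scaleR_scaleC: "r *\<^sub>R a = complex_of_real r *\<^sub>C a"
    and norm_scaleC: "norm (c *\<^sub>C a) = cmod c * norm a"
    and mult_scaleC_left: "(c *\<^sub>C a) * b = c *\<^sub>C (a * b)"
    and mult_scaleC_right: "a * (c *\<^sub>C b) = c *\<^sub>C (a * b)"
    and star_star: "star (star a) = a"
    and star_add: "star (a + b) = star a + star b"
    and star_scaleC: "star (c *\<^sub>C a) = cnj c *\<^sub>C star a"
    and star_mult: "star (a * b) = star b * star a"
    and norm_star_mult: "norm (star a * a) = (norm a)\<^sup>2"

instantiation complex :: cstar_algebra
begin

definition star_complex_def: "star (z :: complex) = cnj z"

instance
  by standard
    (simp_all add: star_complex_def scaleR_conv_of_real norm_mult power2_eq_square algebra_simps)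

end

section \<open>Hilbert spaces\<close>

text \<open>
  A Hilbert space is a complex linear subspace of an ambient vector space (a type) with its own inner
  product, which is linear in the second variable.  The values of the inner product outside the
  carrier are irrelevant.
\<close>

record 'a hspace =
  hcarrier :: "'a set"
  hinner :: "'a \<Rightarrow> 'a \<Rightarrow> complex"

definition hnorm :: "'a hspace \<Rightarrow> 'a \<Rightarrow> real" where
  "hnorm H x = sqrt (Re (hinner H x x))"

text \<open>\<^locale>\<open>Metric_space\<close> asks for symmetry and nonnegativity also outside the carrier.\<close>

definition hdist :: "'a::complex_vector hspace \<Rightarrow> 'a \<Rightarrow> 'a \<Rightarrow> real" where
  "hdist H x y = (if x \<in> hcarrier H \<and> y \<in> hcarrier H then hnorm H (x - y) else 0)"

locale cinner_space =
  fixes H :: "'a::complex_vector hspace"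
  assumes subspace: "csubspace (hcarrier H)"
    and inner_add: "\<lbrakk>x \<in> hcarrier H; y \<in> hcarrier H; z \<in> hcarrier H\<rbrakk>
      \<Longrightarrow> hinner H x (y + z) = hinner H x y + hinner H x z"
    and inner_scaleC: "\<lbrakk>x \<in> hcarrier H; y \<in> hcarrier H\<rbrakk>
      \<Longrightarrow> hinner H x (c *\<^sub>C y) = c * hinner H x y"
    and inner_commute: "\<lbrakk>x \<in> hcarrier H; y \<in> hcarrier H\<rbrakk>
      \<Longrightarrow> hinner H y x = cnj (hinner H x y)"
    and inner_ge_zero: "x \<in> hcarrier H \<Longrightarrow> 0 \<le> hinner H x x"
    and inner_eq_zero: "\<lbrakk>x \<in> hcarrier H; hinner H x x = 0\<rbrakk> \<Longrightarrow> x = 0"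
begin

lemma mem_add: "x \<in> hcarrier H \<Longrightarrow> y \<in> hcarrier H \<Longrightarrow> x + y \<in> hcarrier H"
  and mem_diff: "x \<in> hcarrier H \<Longrightarrow> y \<in> hcarrier H \<Longrightarrow> x - y \<in> hcarrier H"
  and mem_scaleC: "x \<in> hcarrier H \<Longrightarrow> c *\<^sub>C x \<in> hcarrier H"
  and mem_zero: "0 \<in> hcarrier H"
  using subspace
  by (simp_all add: complex_vector.subspace_add complex_vector.subspace_diff
      complex_vector.subspace_scale complex_vector.subspace_0)

lemma inner_zero_right: "x \<in> hcarrier H \<Longrightarrow> hinner H x 0 = 0"
  using inner_scaleC[of x x 0] by (simp add: complex_vector.scale_zero_left)

lemma inner_self_real: "x \<in> hcarrier H \<Longrightarrow> hinner H x x = complex_of_real ((hnorm H x)\<^sup>2)"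
  using inner_ge_zero[of x] by (simp add: hnorm_def less_eq_complex_def complex_eq_iff)

lemma hnorm_nonneg: "x \<in> hcarrier H \<Longrightarrow> 0 \<le> hnorm H x"
  using inner_ge_zero[of x] by (simp add: hnorm_def less_eq_complex_def)

lemma hnorm_eq_zero: "x \<in> hcarrier H \<Longrightarrow> hnorm H x = 0 \<longleftrightarrow> x = 0"
  using inner_self_real[of x] inner_eq_zero[of x] inner_zero_right[of x] by auto

lemma hnorm_scaleC: "x \<in> hcarrier H \<Longrightarrow> hnorm H (c *\<^sub>C x) = cmod c * hnorm H x"
proof -
  assume x: "x \<in> hcarrier H"
  have "hinner H (c *\<^sub>C x) (c *\<^sub>C x) = c * cnj (hinner H x (c *\<^sub>C x))"
    using inner_scaleC[of "c *\<^sub>C x" x c] inner_commute[of x "c *\<^sub>C x"] mem_scaleC[OF x, of c] x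
    by simp
  also have "\<dots> = complex_of_real ((cmod c * hnorm H x)\<^sup>2)"
    using inner_scaleC[OF x x, of c] inner_self_real[OF x] complex_norm_square[of c]
    by (simp add: power_mult_distrib mult.assoc[symmetric])
  finally have "(hnorm H (c *\<^sub>C x))\<^sup>2 = (cmod c * hnorm H x)\<^sup>2"
    using inner_self_real[OF mem_scaleC[OF x, of c]] by (metis of_real_eq_iff)
  then show ?thesis
    using hnorm_nonneg[OF x] hnorm_nonneg[OF mem_scaleC[OF x, of c]] by (simp add: power2_eq_iff_nonneg)
qed

lemma inner_scaleC_left:
  assumes "x \<in> hcarrier H" "y \<in> hcarrier H"
  shows "hinner H (c *\<^sub>C x) y = cnj c * hinner H x y"
  using inner_commute[of y "c *\<^sub>C x"] inner_commute[of y x] inner_scaleC[of y x c] mem_scaleC assms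
  by simp

lemma hnorm_add_squared:
  assumes x: "x \<in> hcarrier H" and y: "y \<in> hcarrier H"
  shows "(hnorm H (x + y))\<^sup>2 = (hnorm H x)\<^sup>2 + (hnorm H y)\<^sup>2 + 2 * Re (hinner H x y)"
proof -
  have xy: "x + y \<in> hcarrier H" using mem_add x y .
  have "hinner H (x + y) (x + y) = hinner H (x + y) x + hinner H (x + y) y"
    using inner_add[OF xy x y] .
  also have "\<dots> = cnj (hinner H x (x + y)) + cnj (hinner H y (x + y))"
    using inner_commute[OF x xy] inner_commute[OF y xy] by simp
  also have "\<dots> = cnj (hinner H x x + hinner H x y) + cnj (cnj (hinner H x y) + hinner H y y)"
    using inner_add[OF x x y] inner_add[OF y x y] inner_commute[OF x y] by simp
  finally have "Re (hinner H (x + y) (x + y))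
      = Re (hinner H x x) + Re (hinner H y y) + 2 * Re (hinner H x y)"
    by simp
  then show ?thesis
    using inner_self_real[OF x] inner_self_real[OF y] inner_self_real[OF xy] by simp
qed

lemma Cauchy_Schwarz_Re:
  assumes x: "x \<in> hcarrier H" and y: "y \<in> hcarrier H"
  shows "Re (hinner H x y) \<le> hnorm H x * hnorm H y"
proof (cases "hnorm H x = 0 \<or> hnorm H y = 0")
  case True
  then have "x = 0 \<or> y = 0" using hnorm_eq_zero x y by blast
  then show ?thesis
    using inner_zero_right[OF x] inner_zero_right[OF y] inner_commute[OF y x] True by auto
next
  case False
  define p where "p = hnorm H x"
  define q where "q = hnorm H y"
  have pq: "p > 0" "q > 0"
    using False hnorm_nonneg[OF x] hnorm_nonneg[OF y] by (auto simp: p_def q_def less_le)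
  define x' where "x' = complex_of_real q *\<^sub>C x"
  define r where "r = - p"
  define y' where "y' = complex_of_real r *\<^sub>C y"
  have mem: "x' \<in> hcarrier H" "y' \<in> hcarrier H"
    unfolding x'_def y'_def using mem_scaleC x y by blast+
  have ip: "hinner H x' y' = complex_of_real (q * r) * hinner H x y"
    unfolding x'_def y'_def
    using inner_scaleC_left[OF x mem_scaleC[OF y]] inner_scaleC[OF x y] by simp
  have "0 \<le> (hnorm H (x' + y'))\<^sup>2" by simp
  also have "\<dots> = (q * p)\<^sup>2 + (r * q)\<^sup>2 + 2 * Re (hinner H x' y')"
    unfolding hnorm_add_squared[OF mem] using pq hnorm_scaleC[OF x] hnorm_scaleC[OF y]
    by (simp add: x'_def y'_def p_def q_def power_mult_distrib)
  also have "\<dots> = 2 * (p * q) * (p * q - Re (hinner H x y))"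
    unfolding ip r_def by (simp add: power2_eq_square algebra_simps)
  finally show ?thesis
    using mult_pos_pos[OF pq] by (auto simp: zero_le_mult_iff p_def q_def)
qed

lemma hnorm_triangle:
  assumes x: "x \<in> hcarrier H" and y: "y \<in> hcarrier H"
  shows "hnorm H (x + y) \<le> hnorm H x + hnorm H y"
proof (rule power2_le_imp_le)
  show "(hnorm H (x + y))\<^sup>2 \<le> (hnorm H x + hnorm H y)\<^sup>2"
    using hnorm_add_squared[OF x y] Cauchy_Schwarz_Re[OF x y] by (simp add: power2_sum)
  show "0 \<le> hnorm H x + hnorm H y"
    using hnorm_nonneg x y by simp
qed

sublocale Metric_space "hcarrier H" "hdist H"
proof
  fix x y z
  show "0 \<le> hdist H x y"
    using hnorm_nonneg mem_diff by (simp add: hdist_def)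
  show "hdist H x y = hdist H y x"
  proof (cases "x \<in> hcarrier H \<and> y \<in> hcarrier H")
    case True
    then have "hnorm H ((- 1) *\<^sub>C (x - y)) = hnorm H (x - y)"
      using hnorm_scaleC[OF mem_diff, of x y "- 1"] by simp
    then show ?thesis
      using True by (simp add: hdist_def complex_vector.scale_minus_left scaleC_one)
  qed (auto simp: hdist_def)
  show "hdist H x y = 0 \<longleftrightarrow> x = y" if "x \<in> hcarrier H" "y \<in> hcarrier H"
    using that hnorm_eq_zero[OF mem_diff, of x y] by (simp add: hdist_def)
  show "hdist H x z \<le> hdist H x y + hdist H y z"
    if "x \<in> hcarrier H" "y \<in> hcarrier H" "z \<in> hcarrier H"
    using that hnorm_triangle[OF mem_diff mem_diff, of x y y z] by (simp add: hdist_def)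
qed

end

locale hilbert_space = cinner_space +
  assumes complete: mcomplete

definition closed_span :: "'a::complex_vector hspace \<Rightarrow> 'a set \<Rightarrow> 'a set" where
  "closed_span H S = Metric_space.mtopology (hcarrier H) (hdist H) closure_of cspan S"

section \<open>Operators\<close>

text \<open>Operators are total functions of which only the restriction to the carrier matters.\<close>

definition linear_between ::
    "'a::complex_vector hspace \<Rightarrow> 'b::complex_vector hspace \<Rightarrow> ('a \<Rightarrow> 'b) \<Rightarrow> bool" where
  "linear_between H L T \<longleftrightarrow> T \<in> hcarrier H \<rightarrow> hcarrier L
    \<and> (\<forall>x\<in>hcarrier H. \<forall>y\<in>hcarrier H. T (x + y) = T x + T y)
    \<and> (\<forall>c. \<forall>x\<in>hcarrier H. T (c *\<^sub>C x) = c *\<^sub>C T x)"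

definition bounded_operators ::
    "'a::complex_vector hspace \<Rightarrow> 'b::complex_vector hspace \<Rightarrow> ('a \<Rightarrow> 'b) set" where
  "bounded_operators H L =
    {T. linear_between H L T \<and> (\<exists>M. \<forall>x\<in>hcarrier H. hnorm L (T x) \<le> M * hnorm H x)}"

definition operator_norm ::
    "'a::complex_vector hspace \<Rightarrow> 'b::complex_vector hspace \<Rightarrow> ('a \<Rightarrow> 'b) \<Rightarrow> real" where
  "operator_norm H L T = (SUP x\<in>{x \<in> hcarrier H. hnorm H x \<le> 1}. hnorm L (T x))"

definition adjoint_op ::
    "'a::complex_vector hspace \<Rightarrow> 'b::complex_vector hspace \<Rightarrow> ('a \<Rightarrow> 'b) \<Rightarrow> 'b \<Rightarrow> 'a" where
  "adjoint_op H L T y =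
    (THE z. z \<in> hcarrier H \<and> (\<forall>x\<in>hcarrier H. hinner H x z = hinner L (T x) y))"

definition unitary_operators ::
    "'a::complex_vector hspace \<Rightarrow> 'b::complex_vector hspace \<Rightarrow> ('a \<Rightarrow> 'b) set" where
  "unitary_operators H L = {W \<in> bounded_operators H L. W ` hcarrier H = hcarrier L
    \<and> (\<forall>x\<in>hcarrier H. \<forall>y\<in>hcarrier H. hinner L (W x) (W y) = hinner H x y)}"

definition unitarily_isomorphic ::
    "'a::complex_vector hspace \<Rightarrow> 'b::complex_vector hspace \<Rightarrow> bool" where
  "unitarily_isomorphic H L \<longleftrightarrow> unitary_operators H L \<noteq> {}"

definition bounded_maps_into_operators ::
    "'h::complex_vector hspace \<Rightarrow> ('a::cstar_algebra \<Rightarrow> 'h \<Rightarrow> 'h) set" where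
  "bounded_maps_into_operators H = {\<Phi>.
      (\<forall>a. \<Phi> a \<in> bounded_operators H H)
    \<and> (\<forall>a b. \<forall>u\<in>hcarrier H. \<Phi> (a + b) u = \<Phi> a u + \<Phi> b u)
    \<and> (\<forall>c a. \<forall>u\<in>hcarrier H. \<Phi> (c *\<^sub>C a) u = c *\<^sub>C \<Phi> a u)
    \<and> (\<exists>M. \<forall>a. operator_norm H H (\<Phi> a) \<le> M * norm a)}"

text \<open>A *-homomorphism into the bounded operators; it is not required to preserve the unit.\<close>

definition star_representation ::
    "'l::complex_vector hspace \<Rightarrow> ('a::cstar_algebra \<Rightarrow> 'l \<Rightarrow> 'l) \<Rightarrow> bool" where
  "star_representation L \<pi> \<longleftrightarrow>
      (\<forall>a. \<pi> a \<in> bounded_operators L L)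
    \<and> (\<forall>a b. \<forall>x\<in>hcarrier L. \<pi> (a + b) x = \<pi> a x + \<pi> b x)
    \<and> (\<forall>c a. \<forall>x\<in>hcarrier L. \<pi> (c *\<^sub>C a) x = c *\<^sub>C \<pi> a x)
    \<and> (\<forall>a b. \<forall>x\<in>hcarrier L. \<pi> (a * b) x = \<pi> a (\<pi> b x))
    \<and> (\<forall>a. \<forall>x\<in>hcarrier L. \<pi> (star a) x = adjoint_op L L (\<pi> a) x)"

section \<open>Kernels\<close>

definition positive_definite_kernel ::
    "'x set \<Rightarrow> 'h::complex_vector hspace \<Rightarrow> ('x \<Rightarrow> 'x \<Rightarrow> 'a::cstar_algebra \<Rightarrow> 'h \<Rightarrow> 'h) \<Rightarrow> bool" where
  "positive_definite_kernel X H K \<longleftrightarrow>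
    (\<forall>(N::nat) (u :: nat \<Rightarrow> 'h) (s :: nat \<Rightarrow> 'x) (a :: nat \<Rightarrow> 'a).
      (\<forall>i\<in>{1..N}. u i \<in> hcarrier H \<and> s i \<in> X) \<longrightarrow>
      0 \<le> (\<Sum>i=1..N. \<Sum>j=1..N. hinner H (u i) (K (s i) (s j) (star (a i) * a j) (u j))))"

definition scalar_domain :: "'x set \<Rightarrow> 'h hspace \<Rightarrow> ('x \<times> 'a \<times> 'h) set" where
  "scalar_domain X H = X \<times> UNIV \<times> hcarrier H"

definition scalar_kernel ::
    "'h hspace \<Rightarrow> ('x \<Rightarrow> 'x \<Rightarrow> 'a::cstar_algebra \<Rightarrow> 'h \<Rightarrow> 'h)
      \<Rightarrow> 'x \<times> 'a \<times> 'h \<Rightarrow> 'x \<times> 'a \<times> 'h \<Rightarrow> complex" where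
  "scalar_kernel H K = (\<lambda>(s, a, u) (t, b, v). hinner H u (K s t (star a * b) v))"

text \<open>
  Functions on \<open>\<Omega>\<close> are represented by functions on the whole type that vanish outside \<open>\<Omega>\<close>.
  The reproducing kernel Hilbert space of \<open>k\<close> is described by its defining property; the
  conditions determine the carrier and the inner product on it.
\<close>

definition kernel_section :: "'w set \<Rightarrow> ('w \<Rightarrow> 'w \<Rightarrow> complex) \<Rightarrow> 'w \<Rightarrow> 'w \<Rightarrow> complex" where
  "kernel_section \<Omega> k y = (\<lambda>x. if x \<in> \<Omega> then k x y else 0)"

definition is_rkhs :: "'w set \<Rightarrow> ('w \<Rightarrow> 'w \<Rightarrow> complex) \<Rightarrow> ('w \<Rightarrow> complex) hspace \<Rightarrow> bool" where
  "is_rkhs \<Omega> k F \<longleftrightarrow> hilbert_space F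
    \<and> (\<forall>f\<in>hcarrier F. \<forall>x. x \<notin> \<Omega> \<longrightarrow> f x = 0)
    \<and> (\<forall>y\<in>\<Omega>. kernel_section \<Omega> k y \<in> hcarrier F)
    \<and> (\<forall>f\<in>hcarrier F. \<forall>y\<in>\<Omega>. f y = hinner F (kernel_section \<Omega> k y) f)"

section \<open>Factorizations\<close>

definition factorization ::
    "'x set \<Rightarrow> 'h::complex_vector hspace \<Rightarrow> ('x \<Rightarrow> 'x \<Rightarrow> 'a::cstar_algebra \<Rightarrow> 'h \<Rightarrow> 'h)
      \<Rightarrow> 'l::complex_vector hspace \<Rightarrow> ('a \<Rightarrow> 'l \<Rightarrow> 'l) \<Rightarrow> ('x \<Rightarrow> 'h \<Rightarrow> 'l) \<Rightarrow> bool" where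
  "factorization X H K L \<pi> V \<longleftrightarrow>
      hilbert_space L \<and> star_representation L \<pi>
    \<and> (\<forall>t\<in>X. V t \<in> bounded_operators H L)
    \<and> (\<forall>s\<in>X. \<forall>t\<in>X. \<forall>a. \<forall>u\<in>hcarrier H.
         K s t a u = adjoint_op H L (V s) (\<pi> a (V t u)))"

definition minimal_factorization ::
    "'x set \<Rightarrow> 'h::complex_vector hspace \<Rightarrow> ('x \<Rightarrow> 'x \<Rightarrow> 'a::cstar_algebra \<Rightarrow> 'h \<Rightarrow> 'h)
      \<Rightarrow> 'l::complex_vector hspace \<Rightarrow> ('a \<Rightarrow> 'l \<Rightarrow> 'l) \<Rightarrow> ('x \<Rightarrow> 'h \<Rightarrow> 'l) \<Rightarrow> bool" where
  "minimal_factorization X H K L \<pi> V \<longleftrightarrow> factorization X H K L \<pi> V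
    \<and> hcarrier L = closed_span L {\<pi> a (V t u) | a t u. t \<in> X \<and> u \<in> hcarrier H}"

end

theory Submission
  imports Defs
begin

text \<open>
  The reproducing kernel Hilbert space \<open>F\<close> of the scalar kernel consists of the pointwise limits of
  Cauchy sequences in the span of the kernel sections.  On it,
  \<open>(\<pi>(a) f)(s, c, u) = f(s, a\<^sup>* c, u)\<close> and \<open>V(t) u\<close> is the kernel section at \<open>(t, 1, u)\<close>; that
  \<open>\<pi>(a)\<close> is bounded by \<open>\<parallel>a\<parallel>\<close> comes from iterating the Cauchy-Schwarz inequality along the powers
  \<open>(a\<^sup>* a)\<^bsup>2^n\<^esup>\<close>.  Conversely, a minimal factorization through \<open>L\<close> is carried onto \<open>F\<close> by the explicit
  unitary \<open>x \<mapsto> ((s, a, u) \<mapsto> \<langle>\<pi>(a) V(s) u, x\<rangle>)\<close>, surjective by the Riesz representation theorem.  Its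
  effect on \<open>V(t) u\<close> and \<open>\<pi>(a) x\<close> depends on \<open>K\<close> alone, so composing two such unitaries gives the
  uniqueness of \<open>L\<close>.
\<close>

section \<open>Sequences in inner product spaces\<close>

text \<open>The obstacle is the boundedness of the operators on F: the kernel alone controls the
  image of a fixed vector only up to a constant that depends on this vector. The usual remedy writes
  \<open>(norm a)^2 - star a * a\<close> as \<open>star b * b\<close>, which needs functional
  calculus. The squaring iteration needs only submultiplicativity and the C*-identity, because a
  constant disappears under roots of order 2^n. Elements of F are genuine functions, not classes of
  Cauchy sequences. Hence operators are given by formulas that make sense for every function,
  algebraic laws are checked pointwise, and norm limits are recognised by their values. The unitary
  from L is likewise defined on all vectors at once, so well-definedness on a span is no issue; the
  work lies in showing that its values belong to F. There F is an arbitrary space with the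
  reproducing property, and Riesz gives surjectivity without first showing that the kernel sections
  are dense in F.\<close>

definition hconverges :: "'a::complex_vector hspace \<Rightarrow> (nat \<Rightarrow> 'a) \<Rightarrow> 'a \<Rightarrow> bool" where
  "hconverges H \<sigma> x \<longleftrightarrow> range \<sigma> \<subseteq> hcarrier H \<and> x \<in> hcarrier H \<and> (\<lambda>n. hnorm H (\<sigma> n - x)) \<longlonglongrightarrow> 0"

text \<open>Unlike \<open>MCauchy\<close>, this speaks of \<open>hnorm\<close> directly. The metric
  topology enters only in \<open>closed_span_hconverges\<close>, \<open>hilbert_spaceI\<close> and
  \<open>hCauchy_imp_hconverges\<close>, which translate between the two languages.\<close>

definition hCauchy :: "'a::complex_vector hspace \<Rightarrow> (nat \<Rightarrow> 'a) \<Rightarrow> bool" where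
  "hCauchy H \<sigma> \<longleftrightarrow> range \<sigma> \<subseteq> hcarrier H \<and>
     (\<forall>e>0. \<exists>N. \<forall>m\<ge>N. \<forall>n\<ge>N. hnorm H (\<sigma> m - \<sigma> n) < e)"

lemma hCauchyD:
  "hCauchy H \<sigma> \<Longrightarrow> e > 0 \<Longrightarrow> \<exists>N. \<forall>m\<ge>N. \<forall>n\<ge>N. hnorm H (\<sigma> m - \<sigma> n) < e"
  by (auto simp: hCauchy_def)

context cinner_space
begin

lemma mem_sum: "(\<And>i. i \<in> I \<Longrightarrow> f i \<in> hcarrier H) \<Longrightarrow> sum f I \<in> hcarrier H"
  by (induction I rule: infinite_finite_induct) (simp_all add: mem_zero mem_add)

lemma mem_cspan: "S \<subseteq> hcarrier H \<Longrightarrow> x \<in> cspan S \<Longrightarrow> x \<in> hcarrier H"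
  using complex_vector.span_minimal[OF _ subspace] by blast

lemma inner_add_left:
  assumes "x \<in> hcarrier H" "y \<in> hcarrier H" "z \<in> hcarrier H"
  shows "hinner H (x + y) z = hinner H x z + hinner H y z"
  using inner_commute[of z "x + y"] inner_add[of z x y] inner_commute[of z x] inner_commute[of z y]
  by (simp add: assms mem_add)

lemma inner_zero_left: "x \<in> hcarrier H \<Longrightarrow> hinner H 0 x = 0"
  using inner_commute[of x 0] inner_zero_right[of x] by (simp add: mem_zero)

lemma inner_diff:
  assumes "x \<in> hcarrier H" "y \<in> hcarrier H" "z \<in> hcarrier H"
  shows "hinner H x (y - z) = hinner H x y - hinner H x z"
  using inner_add[of x "y - z" z] by (simp add: assms mem_diff)

lemma inner_diff_left:
  assumes "x \<in> hcarrier H" "y \<in> hcarrier H" "z \<in> hcarrier H"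
  shows "hinner H (x - y) z = hinner H x z - hinner H y z"
  using inner_add_left[of "x - y" y z] by (simp add: assms mem_diff)

lemma inner_sum:
  assumes "x \<in> hcarrier H" "\<And>i. i \<in> I \<Longrightarrow> f i \<in> hcarrier H"
  shows "hinner H x (sum f I) = (\<Sum>i\<in>I. hinner H x (f i))"
  using assms(2)
  by (induction I rule: infinite_finite_induct)
    (simp_all add: inner_zero_right inner_add mem_sum assms(1))

lemma inner_sum_left:
  assumes "x \<in> hcarrier H" "\<And>i. i \<in> I \<Longrightarrow> f i \<in> hcarrier H"
  shows "hinner H (sum f I) x = (\<Sum>i\<in>I. hinner H (f i) x)"
  using assms(2)
  by (induction I rule: infinite_finite_induct)
    (simp_all add: inner_zero_left inner_add_left mem_sum assms(1))

lemma inner_eqI: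
  assumes "x \<in> hcarrier H" "y \<in> hcarrier H"
    and "\<And>z. z \<in> hcarrier H \<Longrightarrow> hinner H z x = hinner H z y"
  shows "x = y"
  using inner_eq_zero[of "x - y"] inner_diff[of "x - y" x y] assms mem_diff by simp

lemma hnorm_zero: "hnorm H 0 = 0"
  using hnorm_eq_zero[OF mem_zero] by simp

lemma hnorm_minus: "x \<in> hcarrier H \<Longrightarrow> y \<in> hcarrier H \<Longrightarrow> hnorm H (x - y) = hnorm H (y - x)"
  using commute[of x y] by (simp add: hdist_def)

lemma hnorm_diff_triangle:
  assumes "x \<in> hcarrier H" "y \<in> hcarrier H" "z \<in> hcarrier H"
  shows "hnorm H (x - z) \<le> hnorm H (x - y) + hnorm H (y - z)"
  using hnorm_triangle[of "x - y" "y - z"] assms mem_diff by simp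

lemma hnorm_triangle_diff:
  assumes "x \<in> hcarrier H" "y \<in> hcarrier H"
  shows "\<bar>hnorm H x - hnorm H y\<bar> \<le> hnorm H (x - y)"
  using hnorm_triangle[of "x - y" y] hnorm_triangle[of "y - x" x] assms mem_diff hnorm_minus[of x y]
  by simp

text \<open>Multiplying \<open>y\<close> by a suitable phase \<open>c\<close> turns the inner
  product into its modulus, so the bound on real parts already gives the complex one.\<close>

lemma Cauchy_Schwarz:
  assumes x: "x \<in> hcarrier H" and y: "y \<in> hcarrier H"
  shows "cmod (hinner H x y) \<le> hnorm H x * hnorm H y"
proof (cases "hinner H x y = 0")
  case True
  then show ?thesis using hnorm_nonneg x y by simp
next
  case False
  define c where "c = cnj (hinner H x y) / of_real (cmod (hinner H x y))"
  have c: "cmod c = 1" using False by (simp add: c_def norm_divide)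
  have "hinner H x (c *\<^sub>C y) = of_real (cmod (hinner H x y))"
    using False by (simp add: inner_scaleC[OF x y] c_def complex_norm_square[symmetric]
        power2_eq_square mult.commute[of "cnj _"])
  then show ?thesis
    using Cauchy_Schwarz_Re[OF x mem_scaleC[OF y, of c]] hnorm_scaleC[OF y, of c] c by simp
qed

lemma parallelogram:
  assumes "x \<in> hcarrier H" "y \<in> hcarrier H"
  shows "(hnorm H (x - y))\<^sup>2 + (hnorm H (x + y))\<^sup>2 = 2 * (hnorm H x)\<^sup>2 + 2 * (hnorm H y)\<^sup>2"
proof -
  have "- y = (- 1) *\<^sub>C y"
    by (simp add: complex_vector.scale_minus_left scaleC_one)
  then have "x - y = x + (- 1) *\<^sub>C y" by simp
  then have "(hnorm H (x - y))\<^sup>2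
      = (hnorm H x)\<^sup>2 + (hnorm H ((- 1) *\<^sub>C y))\<^sup>2 + 2 * Re (hinner H x ((- 1) *\<^sub>C y))"
    using hnorm_add_squared[OF assms(1) mem_scaleC[OF assms(2)]] by metis
  then show ?thesis
    using hnorm_add_squared[OF assms] hnorm_scaleC[OF assms(2), of "-1"] inner_scaleC[OF assms, of "-1"]
    by simp
qed

lemma hconverges_mem: "hconverges H \<sigma> x \<Longrightarrow> \<sigma> n \<in> hcarrier H" "hconverges H \<sigma> x \<Longrightarrow> x \<in> hcarrier H"
  by (auto simp: hconverges_def)

lemma hCauchy_mem: "hCauchy H \<sigma> \<Longrightarrow> \<sigma> n \<in> hcarrier H"
  by (auto simp: hCauchy_def)

lemma hCauchy_const: "x \<in> hcarrier H \<Longrightarrow> hCauchy H (\<lambda>n. x)"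
  by (auto simp: hCauchy_def hnorm_zero)

lemma hconverges_imp_hCauchy:
  assumes "hconverges H \<sigma> x"
  shows "hCauchy H \<sigma>"
  unfolding hCauchy_def
proof (intro conjI allI impI)
  show "range \<sigma> \<subseteq> hcarrier H" using assms by (simp add: hconverges_def)
  fix e :: real assume "e > 0"
  then have "\<forall>\<^sub>F n in sequentially. hnorm H (\<sigma> n - x) < e / 2"
    using assms by (intro order_tendstoD) (auto simp: hconverges_def)
  then obtain N where N: "\<And>n. n \<ge> N \<Longrightarrow> hnorm H (\<sigma> n - x) < e / 2"
    by (auto simp: eventually_sequentially)
  have "hnorm H (\<sigma> m - \<sigma> n) < e" if "m \<ge> N" "n \<ge> N" for m n
    using hnorm_diff_triangle[of "\<sigma> m" x "\<sigma> n"] N[OF that(1)] N[OF that(2)]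
      hnorm_minus[of "\<sigma> n" x] hconverges_mem[OF assms] by simp
  then show "\<exists>N. \<forall>m\<ge>N. \<forall>n\<ge>N. hnorm H (\<sigma> m - \<sigma> n) < e" by blast
qed

lemma hCauchy_bounded:
  assumes "hCauchy H \<sigma>"
  obtains B where "B > 0" "\<And>n. hnorm H (\<sigma> n) \<le> B"
proof -
  obtain N where N: "\<And>n. n \<ge> N \<Longrightarrow> hnorm H (\<sigma> N - \<sigma> n) < 1"
    using hCauchyD[OF assms, of 1] by auto
  \<comment> \<open>The tail stays within 1 of \<open>\<sigma> N\<close>, and the sum covers the
    finitely many earlier terms. The summand 1 also makes \<open>B\<close> positive, so that later
    proofs may divide by it.\<close>
  define B where "B = 1 + hnorm H (\<sigma> N) + (\<Sum>i<N. hnorm H (\<sigma> i))"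
  have nonneg: "hnorm H (\<sigma> i) \<ge> 0" for i
    using hnorm_nonneg hCauchy_mem[OF assms] by simp
  have sum: "(\<Sum>i<N. hnorm H (\<sigma> i)) \<ge> 0"
    by (simp add: sum_nonneg nonneg)
  have "hnorm H (\<sigma> n) \<le> B" for n
  proof (cases "n \<ge> N")
    case True
    have "hnorm H (\<sigma> n) \<le> hnorm H (\<sigma> N) + 1"
      using hnorm_triangle_diff[of "\<sigma> N" "\<sigma> n"] N[OF True] hCauchy_mem[OF assms] by (simp add: abs_if split: if_splits)
    then show ?thesis using sum by (simp add: B_def)
  next
    case False
    then have "hnorm H (\<sigma> n) \<le> (\<Sum>i<N. hnorm H (\<sigma> i))"
      by (intro member_le_sum) (auto simp: nonneg)
    then show ?thesis using nonneg[of N] by (simp add: B_def)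
  qed
  moreover have "B > 0" using sum nonneg[of N] by (simp add: B_def)
  ultimately show thesis using that by blast
qed

lemma hconverges_hnorm:
  assumes "hconverges H \<sigma> x"
  shows "(\<lambda>n. hnorm H (\<sigma> n)) \<longlonglongrightarrow> hnorm H x"
proof -
  have "(\<lambda>n. hnorm H (\<sigma> n) - hnorm H x) \<longlonglongrightarrow> 0"
    by (rule Lim_null_comparison[of _ "\<lambda>n. hnorm H (\<sigma> n - x)"])
      (use assms hnorm_triangle_diff hconverges_mem[OF assms] in \<open>auto simp: hconverges_def\<close>)
  then show ?thesis by (simp add: LIM_zero_iff)
qed

lemma hconverges_inner:
  assumes "hconverges H \<sigma> x" and y: "y \<in> hcarrier H"
  shows "(\<lambda>n. hinner H y (\<sigma> n)) \<longlonglongrightarrow> hinner H y x"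
proof -
  note mem = hconverges_mem[OF assms(1)]
  have "(\<lambda>n. hinner H y (\<sigma> n) - hinner H y x) \<longlonglongrightarrow> 0"
  proof (rule Lim_null_comparison)
    show "\<forall>\<^sub>F n in sequentially.
        norm (hinner H y (\<sigma> n) - hinner H y x) \<le> hnorm H y * hnorm H (\<sigma> n - x)"
      using Cauchy_Schwarz[OF y mem_diff] inner_diff[OF y] mem by (intro always_eventually allI) metis
    show "(\<lambda>n. hnorm H y * hnorm H (\<sigma> n - x)) \<longlonglongrightarrow> 0"
      using assms(1) by (auto simp: hconverges_def intro!: tendsto_mult_right_zero)
  qed
  then show ?thesis by (simp add: LIM_zero_iff)
qed

lemma hconverges_inner_left:
  assumes "hconverges H \<sigma> x" and y: "y \<in> hcarrier H"
  shows "(\<lambda>n. hinner H (\<sigma> n) y) \<longlonglongrightarrow> hinner H x y"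
proof -
  note mem = hconverges_mem[OF assms(1)]
  have "(\<lambda>n. cnj (hinner H y (\<sigma> n))) \<longlonglongrightarrow> cnj (hinner H y x)"
    using hconverges_inner[OF assms] by (rule tendsto_cnj)
  then show ?thesis
    using inner_commute[OF y] mem by simp
qed

lemma closed_span_hconverges:
  assumes S: "S \<subseteq> hcarrier H" and x: "x \<in> closed_span H S"
  obtains \<sigma> where "range \<sigma> \<subseteq> cspan S" "hconverges H \<sigma> x"
proof -
  have xH: "x \<in> hcarrier H" and "\<forall>r>0. \<exists>y\<in>cspan S. y \<in> mball x r"
    using x unfolding closed_span_def metric_closure_of by auto
  then have "\<forall>n. \<exists>y\<in>cspan S. y \<in> mball x (1 / real (Suc n))"
    by (simp del: of_nat_Suc)
  then obtain \<sigma> where \<sigma>: "\<And>n. \<sigma> n \<in> cspan S" "\<And>n. \<sigma> n \<in> mball x (1 / real (Suc n))"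
    by metis
  have mem: "\<sigma> n \<in> hcarrier H" for n
    using \<sigma>(1) mem_cspan[OF S] by blast
  have "hnorm H (\<sigma> n - x) \<le> 1 / real (Suc n)" for n
    using \<sigma>(2)[of n] hnorm_minus[OF xH mem] by (simp add: hdist_def xH mem)
  then have "(\<lambda>n. hnorm H (\<sigma> n - x)) \<longlonglongrightarrow> 0"
    by (intro Lim_null_comparison[OF _ LIMSEQ_Suc[OF lim_1_over_n]])
      (auto simp: hnorm_nonneg mem_diff mem xH)
  then show thesis
    using that \<sigma>(1) mem xH by (auto simp: hconverges_def)
qed

lemma hilbert_spaceI:
  assumes "\<And>\<sigma>. hCauchy H \<sigma> \<Longrightarrow> \<exists>x. hconverges H \<sigma> x"
  shows "hilbert_space H"
proof
  show mcomplete
    unfolding mcomplete_def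
  proof (intro allI impI)
    fix \<sigma> assume M: "MCauchy \<sigma>"
    then have mem: "\<sigma> n \<in> hcarrier H" for n by (auto simp: MCauchy_def)
    have "hCauchy H \<sigma>"
      using M mem unfolding MCauchy_def hCauchy_def by (simp add: hdist_def)
    then obtain x where x: "hconverges H \<sigma> x" using assms by blast
    then have xH: "x \<in> hcarrier H" by (simp add: hconverges_def)
    have "\<exists>N. \<forall>n\<ge>N. hnorm H (\<sigma> n - x) < e" if "e > 0" for e
      using x order_tendstoD(2)[of "\<lambda>n. hnorm H (\<sigma> n - x)" 0 sequentially e] that
      by (auto simp: hconverges_def eventually_sequentially)
    then show "\<exists>x. limitin mtopology \<sigma> x sequentially"
      unfolding limit_metric_sequentially using xH mem by (auto simp: hdist_def intro!: exI[of _ x])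
  qed
qed

end

section \<open>Riesz representation and adjoints\<close>

context hilbert_space
begin

lemma hCauchy_imp_hconverges:
  assumes "hCauchy H \<sigma>"
  obtains x where "hconverges H \<sigma> x"
proof -
  have mem: "\<sigma> n \<in> hcarrier H" for n using hCauchy_mem[OF assms] .
  have "MCauchy \<sigma>"
    using assms mem unfolding MCauchy_def hCauchy_def by (simp add: hdist_def)
  then obtain x where "limitin mtopology \<sigma> x sequentially"
    using complete by (auto simp: mcomplete_def)
  then have x: "x \<in> hcarrier H" and lim: "\<And>e. e > 0 \<Longrightarrow> \<exists>N. \<forall>n\<ge>N. hdist H (\<sigma> n) x < e"
    unfolding limit_metric_sequentially by blast+
  have "(\<lambda>n. hnorm H (\<sigma> n - x)) \<longlonglongrightarrow> 0"
    unfolding LIMSEQ_def using lim by (simp add: hdist_def x mem hnorm_nonneg mem_diff)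
  then show thesis using that x mem by (auto simp: hconverges_def)
qed

text \<open>The representing vector minimises \<open>\<parallel>x\<parallel>\<^sup>2 - 2 Re (f x)\<close>.\<close>

lemma Riesz_representation:
  assumes add: "\<And>x y. x \<in> hcarrier H \<Longrightarrow> y \<in> hcarrier H \<Longrightarrow> f (x + y) = f x + f y"
    and scale: "\<And>c x. x \<in> hcarrier H \<Longrightarrow> f (c *\<^sub>C x) = c * f x"
    and bound: "\<And>x. x \<in> hcarrier H \<Longrightarrow> cmod (f x) \<le> M * hnorm H x"
  obtains z where "z \<in> hcarrier H" "\<And>x. x \<in> hcarrier H \<Longrightarrow> hinner H z x = f x"
proof -
  define J where "J x = (hnorm H x)\<^sup>2 - 2 * Re (f x)" for x
  define m where "m = (INF x\<in>hcarrier H. J x)"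
  \<comment> \<open>Completing the square: \<open>J x\<close> is at least
    \<open>(hnorm H x - M)^2 - M^2\<close>.\<close>
  have J_lower: "J x \<ge> - M\<^sup>2" if "x \<in> hcarrier H" for x
  proof -
    have "Re (f x) \<le> M * hnorm H x"
      using bound[OF that] complex_Re_le_cmod[of "f x"] by linarith
    then show ?thesis
      using zero_le_power2[of "hnorm H x - M"] by (simp add: J_def power2_diff algebra_simps)
  qed
  have bdd: "bdd_below (J ` hcarrier H)"
    using J_lower by (auto intro!: bdd_belowI)
  have m_le: "m \<le> J x" if "x \<in> hcarrier H" for x
    unfolding m_def using bdd that by (rule cINF_lower)
  have "\<exists>x\<in>hcarrier H. J x < m + e" if "e > 0" for e
    using cInf_lessD[of "J ` hcarrier H" "m + e"] mem_zero that by (auto simp: m_def)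
  then have "\<forall>n. \<exists>x\<in>hcarrier H. J x < m + 1 / real (Suc n)"
    by (simp del: of_nat_Suc)
  then obtain \<sigma> where mem: "\<And>n. \<sigma> n \<in> hcarrier H" and \<sigma>: "\<And>n. J (\<sigma> n) < m + 1 / real (Suc n)"
    by metis
  \<comment> \<open>The parallelogram law at the midpoint \<open>w\<close>, where \<open>J w\<close>
    is at least \<open>m\<close>, forces two near-minimisers to be close to each other; so the
    minimising sequence is Cauchy.\<close>
  have close: "(hnorm H (\<sigma> i - \<sigma> j))\<^sup>2 \<le> 2 / real (Suc i) + 2 / real (Suc j)" for i j
  proof -
    define w where "w = (1/2) *\<^sub>C (\<sigma> i + \<sigma> j)"
    have w: "w \<in> hcarrier H" unfolding w_def by (intro mem_scaleC mem_add mem)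
    have "hnorm H (\<sigma> i + \<sigma> j) = 2 * hnorm H w"
      using hnorm_scaleC[of "\<sigma> i + \<sigma> j" "1/2"] mem_add mem by (simp add: w_def)
    then have "(hnorm H (\<sigma> i + \<sigma> j))\<^sup>2 = 4 * (hnorm H w)\<^sup>2"
      by (simp add: power_mult_distrib)
    moreover have "f (\<sigma> i) + f (\<sigma> j) = 2 * f w"
      using scale[of "\<sigma> i + \<sigma> j" "1/2"] add mem_add mem
      by (simp add: w_def mult.commute)
    then have "Re (f (\<sigma> i)) + Re (f (\<sigma> j)) = 2 * Re (f w)"
      by (simp add: complex_eq_iff)
    ultimately have "(hnorm H (\<sigma> i - \<sigma> j))\<^sup>2 = 2 * J (\<sigma> i) + 2 * J (\<sigma> j) - 4 * J w"
      using parallelogram[OF mem mem, of i j] by (simp add: J_def)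
    then show ?thesis using m_le[OF w] \<sigma>[of i] \<sigma>[of j] by simp
  qed
  have "hCauchy H \<sigma>"
    unfolding hCauchy_def
  proof (intro conjI allI impI)
    show "range \<sigma> \<subseteq> hcarrier H" using mem by blast
    fix e :: real assume e: "e > 0"
    have "(\<lambda>n. 2 / real (Suc n)) \<longlonglongrightarrow> 0"
      using tendsto_mult_right_zero[OF LIMSEQ_Suc[OF lim_1_over_n], of 2] by simp
    then have "\<forall>\<^sub>F n in sequentially. 2 / real (Suc n) < e\<^sup>2 / 2"
      using e by (intro order_tendstoD) auto
    then obtain N where N: "\<And>n. n \<ge> N \<Longrightarrow> 2 / real (Suc n) < e\<^sup>2 / 2"
      by (auto simp: eventually_sequentially)
    have "hnorm H (\<sigma> i - \<sigma> j) < e" if "i \<ge> N" "j \<ge> N" for i j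
      using close[of i j] N[OF that(1)] N[OF that(2)] e
      by (intro power2_less_imp_less[of _ e]) linarith+
    then show "\<exists>N. \<forall>m\<ge>N. \<forall>n\<ge>N. hnorm H (\<sigma> m - \<sigma> n) < e" by blast
  qed
  then obtain z where z: "hconverges H \<sigma> z" by (rule hCauchy_imp_hconverges)
  then have zH: "z \<in> hcarrier H" by (simp add: hconverges_def)
  have f_diff: "f (\<sigma> n) - f z = f (\<sigma> n - z)" for n
    using add[of "\<sigma> n - z" z] mem_diff[OF mem zH] zH by simp
  have "(\<lambda>n. f (\<sigma> n) - f z) \<longlonglongrightarrow> 0"
    unfolding f_diff
    by (rule Lim_null_comparison[of _ "\<lambda>n. M * hnorm H (\<sigma> n - z)"])
      (use z bound mem_diff[OF mem zH] in \<open>auto simp: hconverges_def intro!: tendsto_mult_right_zero\<close>)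
  then have "(\<lambda>n. f (\<sigma> n)) \<longlonglongrightarrow> f z" by (simp add: LIM_zero_iff)
  then have "(\<lambda>n. J (\<sigma> n)) \<longlonglongrightarrow> J z"
    unfolding J_def by (intro tendsto_intros hconverges_hnorm[OF z])
  moreover have "(\<lambda>n. m + 1 / real (Suc n)) \<longlonglongrightarrow> m + 0"
    by (intro tendsto_add tendsto_const LIMSEQ_Suc[OF lim_1_over_n])
  ultimately have "J z \<le> m"
    using LIMSEQ_le[of "\<lambda>n. J (\<sigma> n)" "J z" "\<lambda>n. m + 1 / real (Suc n)" m] \<sigma> by (auto intro: less_imp_le)
  then have min: "J z \<le> J x" if "x \<in> hcarrier H" for x
    using m_le[OF that] by linarith
  \<comment> \<open>First variation of \<open>J\<close> at its minimiser in the direction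
    \<open>x\<close>: a quadratic in \<open>t\<close> without constant term that is never negative
    has no linear term.\<close>
  have Re_eq: "Re (hinner H z x) = Re (f x)" if x: "x \<in> hcarrier H" for x
  proof -
    define D where "D = Re (hinner H z x) - Re (f x)"
    have quad: "0 \<le> t\<^sup>2 * (hnorm H x)\<^sup>2 + 2 * t * D" for t :: real
    proof -
      have tx: "complex_of_real t *\<^sub>C x \<in> hcarrier H" using x by (rule mem_scaleC)
      have "J (z + complex_of_real t *\<^sub>C x) - J z = t\<^sup>2 * (hnorm H x)\<^sup>2 + 2 * t * D"
        unfolding J_def hnorm_add_squared[OF zH tx]
        by (simp add: hnorm_scaleC x add zH tx scale inner_scaleC power_mult_distrib D_def algebra_simps)
      then show ?thesis using min[OF mem_add[OF zH tx]] by linarith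
    qed
    define c where "c = (hnorm H x)\<^sup>2 + 1"
    have c: "c > 0" by (simp add: c_def add_pos_nonneg add.commute)
    \<comment> \<open>At \<open>t = - r\<close> the quadratic is at most
      \<open>c * r^2 - 2 * c * r^2\<close>, since \<open>c\<close> exceeds the squared norm of
      \<open>x\<close>. The 1 in \<open>c\<close> keeps the quotient meaningful for
      \<open>x = 0\<close>.\<close>
    define r where "r = D / c"
    have D: "D = c * r" using c by (simp add: r_def)
    have "r\<^sup>2 * (hnorm H x)\<^sup>2 \<le> r\<^sup>2 * c"
      by (intro mult_left_mono) (simp_all add: c_def)
    then have "c * r\<^sup>2 \<le> 0"
      using quad[of "- r"] by (simp add: D power2_eq_square algebra_simps)
    then have "D = 0" using c by (simp add: D mult_le_0_iff)
    then show ?thesis by (simp add: D_def)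
  qed
  have "hinner H z x = f x" if x: "x \<in> hcarrier H" for x
  proof (rule complex_eqI)
    show "Re (hinner H z x) = Re (f x)" using Re_eq x .
    show "Im (hinner H z x) = Im (f x)"
      using Re_eq[OF mem_scaleC[OF x, of \<i>]] inner_scaleC[OF zH x] scale[OF x] by simp
  qed
  then show thesis using that zH by blast
qed

end

lemma bounded_operatorsD:
  assumes "T \<in> bounded_operators H L"
  shows "x \<in> hcarrier H \<Longrightarrow> T x \<in> hcarrier L"
    and "x \<in> hcarrier H \<Longrightarrow> y \<in> hcarrier H \<Longrightarrow> T (x + y) = T x + T y"
    and "x \<in> hcarrier H \<Longrightarrow> T (c *\<^sub>C x) = c *\<^sub>C T x"
  using assms by (auto simp: bounded_operators_def linear_between_def)

lemma bounded_operators_bound: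
  assumes "cinner_space H" "T \<in> bounded_operators H L"
  obtains M where "M \<ge> 0" "\<And>x. x \<in> hcarrier H \<Longrightarrow> hnorm L (T x) \<le> M * hnorm H x"
proof -
  interpret cinner_space H by fact
  obtain M where M: "\<And>x. x \<in> hcarrier H \<Longrightarrow> hnorm L (T x) \<le> M * hnorm H x"
    using assms(2) by (auto simp: bounded_operators_def)
  have "hnorm L (T x) \<le> \<bar>M\<bar> * hnorm H x" if "x \<in> hcarrier H" for x
    using M[OF that] mult_right_mono[OF abs_ge_self[of M] hnorm_nonneg[OF that]] by linarith
  then show thesis using that[of "\<bar>M\<bar>"] by simp
qed

lemma adjoint_op_eqI:
  assumes "cinner_space H" "z \<in> hcarrier H"
    and "\<And>x. x \<in> hcarrier H \<Longrightarrow> hinner H x z = hinner L (T x) y"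
  shows "adjoint_op H L T y = z"
  unfolding adjoint_op_def
  using cinner_space.inner_eqI[OF assms(1)] assms(2,3) by (intro the_equality) auto

text \<open>Makes the definite description in \<open>adjoint_op\<close> usable: Riesz, applied to
  the functional that sends \<open>x\<close> to the inner product of \<open>y\<close> with
  \<open>T x\<close>, supplies the described vector, and nondegeneracy its uniqueness.\<close>

lemma adjoint_op:
  assumes "hilbert_space H" "cinner_space L" and T: "T \<in> bounded_operators H L" and y: "y \<in> hcarrier L"
  shows "adjoint_op H L T y \<in> hcarrier H"
    and "x \<in> hcarrier H \<Longrightarrow> hinner H x (adjoint_op H L T y) = hinner L (T x) y"
proof -
  interpret H: hilbert_space H by fact
  interpret L: cinner_space L by fact
  note D = bounded_operatorsD[OF T]
  obtain M where M: "M \<ge> 0" "\<And>x. x \<in> hcarrier H \<Longrightarrow> hnorm L (T x) \<le> M * hnorm H x"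
    using bounded_operators_bound[OF H.cinner_space_axioms T] by blast
  obtain z where z: "z \<in> hcarrier H" "\<And>x. x \<in> hcarrier H \<Longrightarrow> hinner H z x = hinner L y (T x)"
  proof (rule H.Riesz_representation[of "\<lambda>x. hinner L y (T x)" "hnorm L y * M"])
    show "cmod (hinner L y (T x)) \<le> hnorm L y * M * hnorm H x" if "x \<in> hcarrier H" for x
      using L.Cauchy_Schwarz[OF y D(1)[OF that]] mult_left_mono[OF M(2)[OF that] L.hnorm_nonneg[OF y]]
      by (simp add: mult.assoc)
  qed (simp_all add: D L.inner_add L.inner_scaleC y)
  have z_eq: "hinner H x z = hinner L (T x) y" if "x \<in> hcarrier H" for x
    using H.inner_commute[OF z(1) that] z(2)[OF that] L.inner_commute[OF y D(1)[OF that]] by simp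
  have "adjoint_op H L T y = z"
    using adjoint_op_eqI[OF H.cinner_space_axioms z(1)] z_eq by blast
  then show "adjoint_op H L T y \<in> hcarrier H"
    "x \<in> hcarrier H \<Longrightarrow> hinner H x (adjoint_op H L T y) = hinner L (T x) y"
    using z(1) z_eq by auto
qed

section \<open>The reproducing kernel Hilbert space\<close>

lemma scaleC_fun_apply [simp]: "(c *\<^sub>C f) x = c *\<^sub>C f x"
  by (simp add: scaleC_fun_def)

lemma sum_fun_apply: "(\<Sum>i\<in>I. f i) x = (\<Sum>i\<in>I. f i x)"
  by (induction I rule: infinite_finite_induct) simp_all

lemma complex_nonneg_iff: "0 \<le> z \<longleftrightarrow> 0 \<le> Re z \<and> Im z = 0" for z :: complex
  by (auto simp: less_eq_complex_def)

section \<open>Positive definite kernels and the inner product on the span of their sections\<close>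

locale pd_kernel =
  fixes \<Omega> :: "'w set" and k :: "'w \<Rightarrow> 'w \<Rightarrow> complex"
  assumes pos: "\<And>S c. finite S \<Longrightarrow> S \<subseteq> \<Omega> \<Longrightarrow> 0 \<le> (\<Sum>x\<in>S. \<Sum>y\<in>S. cnj (c x) * c y * k x y)"
begin

lemma diag_nonneg: "x \<in> \<Omega> \<Longrightarrow> 0 \<le> k x x"
  using pos[of "{x}" "\<lambda>_. 1"] by simp

text \<open>The form at two points with coefficients 1 and \<open>c\<close> is nonnegative, hence
  real. Taking \<open>c = 1\<close> compares the imaginary parts of \<open>k x y\<close> and
  \<open>k y x\<close>, and \<open>c\<close> the imaginary unit compares their real parts.\<close>

lemma hermitian:
  assumes "x \<in> \<Omega>" "y \<in> \<Omega>"
  shows "k y x = cnj (k x y)"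
proof (cases "x = y")
  case True
  then show ?thesis using diag_nonneg[OF assms(2)] by (simp add: complex_nonneg_iff complex_eq_iff)
next
  case False
  have *: "Im (k x x + c * k x y + cnj c * k y x + cnj c * c * k y y) = 0" for c
  proof -
    have "(\<Sum>u\<in>{x, y}. \<Sum>v\<in>{x, y}. cnj (((\<lambda>_. c)(x := 1)) u) * ((\<lambda>_. c)(x := 1)) v * k u v)
        = k x x + c * k x y + cnj c * k y x + cnj c * c * k y y"
      using False by simp
    then show ?thesis
      using pos[of "{x, y}" "(\<lambda>_. c)(x := 1)"] assms by (simp add: complex_nonneg_iff)
  qed
  show ?thesis
    using *[of 1] *[of \<i>] diag_nonneg[OF assms(1)] diag_nonneg[OF assms(2)]
    by (simp add: complex_nonneg_iff complex_eq_iff)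
qed

abbreviation "\<kappa> \<equiv> kernel_section \<Omega> k"

lemma kernel_section_apply: "x \<in> \<Omega> \<Longrightarrow> \<kappa> y x = k x y"
  by (simp add: kernel_section_def)

definition represents :: "'w set \<Rightarrow> ('w \<Rightarrow> complex) \<Rightarrow> ('w \<Rightarrow> complex) \<Rightarrow> bool" where
  "represents S c f \<longleftrightarrow> finite S \<and> S \<subseteq> \<Omega> \<and> f = (\<Sum>x\<in>S. c x *\<^sub>C \<kappa> x)"

lemma represents_apply: "represents S c f \<Longrightarrow> x \<in> \<Omega> \<Longrightarrow> f x = (\<Sum>y\<in>S. c y * k x y)"
  by (simp add: represents_def sum_fun_apply kernel_section_apply)

lemma represents_single: "y \<in> \<Omega> \<Longrightarrow> represents {y} (\<lambda>_. 1) (\<kappa> y)"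
  by (simp add: represents_def)

lemma span_represents:
  assumes "f \<in> cspan (\<kappa> ` \<Omega>)"
  shows "\<exists>S c. represents S c f"
  using assms
proof (induction rule: complex_vector.span_induct_alt)
  case base
  have "represents {} (\<lambda>_. 0) 0" by (simp add: represents_def)
  then show ?case by blast
next
  case (step a x y)
  then obtain w S c where w: "w \<in> \<Omega>" "x = \<kappa> w" and S: "finite S" "S \<subseteq> \<Omega>" and y: "y = (\<Sum>x\<in>S. c x *\<^sub>C \<kappa> x)"
    by (auto simp: represents_def)
  \<comment> \<open>The point \<open>w\<close> may already belong to \<open>S\<close>; its
    coefficient is then increased by \<open>a\<close> instead of being set to
    \<open>a\<close>.\<close>
  define c' where "c' v = (if v \<in> S then c v else 0) + (if v = w then a else 0)" for v
  have "(\<Sum>x\<in>insert w S. c' x *\<^sub>C \<kappa> x)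
      = (\<Sum>x\<in>insert w S. (if x \<in> S then c x else 0) *\<^sub>C \<kappa> x)
        + (\<Sum>x\<in>insert w S. (if x = w then a else 0) *\<^sub>C \<kappa> x)"
    by (simp only: c'_def scaleC_add_left sum.distrib)
  also have "(\<Sum>x\<in>insert w S. (if x \<in> S then c x else 0) *\<^sub>C \<kappa> x) = y"
    unfolding y by (rule sum.mono_neutral_cong_right) (use S in auto)
  also have "(\<Sum>x\<in>insert w S. (if x = w then a else 0) *\<^sub>C \<kappa> x) = (\<Sum>x\<in>{w}. a *\<^sub>C \<kappa> x)"
    by (rule sum.mono_neutral_cong_right) (use S in auto)
  finally have "a *\<^sub>C x + y = (\<Sum>x\<in>insert w S. c' x *\<^sub>C \<kappa> x)"
    unfolding w(2) by (simp only: sum.insert finite.emptyI empty_iff not_False_eq_True sum.empty add_0_right add_0_left add.commute)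
  then have "represents (insert w S) c' (a *\<^sub>C x + y)"
    unfolding represents_def using S w(1) by blast
  then show ?case by blast
qed

text \<open>Only \<open>f\<close> is expanded, with an arbitrarily chosen representation;
  \<open>g\<close> is merely evaluated, as the reproducing property dictates. Hence independence of
  the choice has to be shown for \<open>f\<close> alone, which \<open>pre_inner_eq\<close>
  does.\<close>

definition pre_inner :: "('w \<Rightarrow> complex) \<Rightarrow> ('w \<Rightarrow> complex) \<Rightarrow> complex" where
  "pre_inner f g = (case SOME (S, c). represents S c f of (S, c) \<Rightarrow> \<Sum>x\<in>S. cnj (c x) * g x)"

definition pre_space :: "('w \<Rightarrow> complex) hspace" where
  "pre_space = \<lparr>hcarrier = cspan (\<kappa> ` \<Omega>), hinner = pre_inner\<rparr>"

lemma represents_inner_double: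
  assumes "represents S c f" "represents T d g"
  shows "(\<Sum>x\<in>S. cnj (c x) * g x) = (\<Sum>x\<in>S. \<Sum>y\<in>T. cnj (c x) * d y * k x y)"
proof (rule sum.cong)
  fix x assume "x \<in> S"
  then have "x \<in> \<Omega>" using assms(1) by (auto simp: represents_def)
  then show "cnj (c x) * g x = (\<Sum>y\<in>T. cnj (c x) * d y * k x y)"
    by (simp add: represents_apply[OF assms(2)] sum_distrib_left mult.assoc)
qed simp

text \<open>The core of well-definedness: the right-hand side sees \<open>f\<close> only as a
  function, so any two representations of \<open>f\<close> give the same value on the left. The
  identity itself is the hermitian symmetry of \<open>k\<close> in the double sum.\<close>

lemma represents_inner_commute:
  assumes "represents S c f" "represents T d g"
  shows "(\<Sum>x\<in>S. cnj (c x) * g x) = cnj (\<Sum>y\<in>T. cnj (d y) * f y)"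
proof -
  have "(\<Sum>x\<in>S. cnj (c x) * g x) = (\<Sum>x\<in>S. \<Sum>y\<in>T. cnj (c x) * d y * k x y)"
    by (rule represents_inner_double[OF assms])
  also have "\<dots> = (\<Sum>y\<in>T. \<Sum>x\<in>S. cnj (cnj (d y) * c x * k y x))"
  proof (subst sum.swap, intro sum.cong refl)
    fix x y assume "y \<in> T" "x \<in> S"
    then have "k y x = cnj (k x y)" using assms by (intro hermitian) (auto simp: represents_def)
    then show "cnj (c x) * d y * k x y = cnj (cnj (d y) * c x * k y x)" by simp
  qed
  also have "\<dots> = cnj (\<Sum>y\<in>T. cnj (d y) * f y)"
    unfolding represents_inner_double[OF assms(2,1)] by simp
  finally show ?thesis .
qed

lemma pre_inner_eq:
  assumes f: "represents S c f" and g: "g \<in> cspan (\<kappa> ` \<Omega>)"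
  shows "pre_inner f g = (\<Sum>x\<in>S. cnj (c x) * g x)"
proof -
  obtain S' c' where *: "(SOME (S, c). represents S c f) = (S', c')" by fastforce
  have "represents S' c' f"
    using someI[of "\<lambda>(S, c). represents S c f" "(S, c)"] f * by simp
  moreover obtain T d where "represents T d g" using span_represents[OF g] by blast
  ultimately have "(\<Sum>x\<in>S'. cnj (c' x) * g x) = (\<Sum>x\<in>S. cnj (c x) * g x)"
    using represents_inner_commute[OF f, of T d g] represents_inner_commute[of S' c' f T d g] by simp
  then show ?thesis by (simp add: pre_inner_def *)
qed

lemma pre_inner_kernel_section: "y \<in> \<Omega> \<Longrightarrow> g \<in> cspan (\<kappa> ` \<Omega>) \<Longrightarrow> pre_inner (\<kappa> y) g = g y"
  using pre_inner_eq[OF represents_single] by simp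

lemma kernel_section_mem: "y \<in> \<Omega> \<Longrightarrow> \<kappa> y \<in> cspan (\<kappa> ` \<Omega>)"
  by (simp add: complex_vector.span_base)

lemma span_vanishes: "f \<in> cspan (\<kappa> ` \<Omega>) \<Longrightarrow> x \<notin> \<Omega> \<Longrightarrow> f x = 0"
  using span_represents[of f] by (auto simp: represents_def sum_fun_apply kernel_section_def)

text \<open>The critical axiom is definiteness, because the form is a priori only semidefinite. A
  value \<open>x w\<close> is an inner product with a kernel section, so it vanishes for a null
  vector by a Cauchy-Schwarz argument. This is carried out by hand, as the locale lemmas become
  available only after the axioms.\<close>

lemma cinner_space_pre_space: "cinner_space pre_space"
proof
  let ?P = "cspan (\<kappa> ` \<Omega>)"
  show "csubspace (hcarrier pre_space)"
    by (simp add: pre_space_def complex_vector.subspace_span)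
  fix x y z
  assume x: "x \<in> hcarrier pre_space"
  then have xP: "x \<in> ?P" by (simp add: pre_space_def)
  then obtain S c where S: "represents S c x" using span_represents by blast
  note eq = pre_inner_eq[OF S]
  have "hinner pre_space x x = (\<Sum>u\<in>S. \<Sum>v\<in>S. cnj (c u) * c v * k u v)"
    by (simp add: pre_space_def eq xP represents_inner_double[OF S S])
  then show nonneg: "0 \<le> hinner pre_space x x"
    using S by (auto simp: represents_def intro: pos)
  show "x = 0" if zero: "hinner pre_space x x = 0"
  proof
    fix w
    show "x w = 0 w"
    proof (cases "w \<in> \<Omega>")
      case w: True
      \<comment> \<open>Nonnegativity of the form at \<open>x\<close> plus \<open>t\<close> times
        the section at \<open>w\<close>, where the term with \<open>x\<close> twice is zero by
        assumption.\<close>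
      have quad: "0 \<le> 2 * Re (t * cnj (x w)) + (cmod t)\<^sup>2 * Re (k w w)" for t
      proof -
        let ?y = "t *\<^sub>C \<kappa> w + x"
        have yP: "?y \<in> ?P"
          using xP kernel_section_mem[OF w] by (intro complex_vector.span_add complex_vector.span_scale)
        then obtain T d where T: "represents T d ?y" using span_represents by blast
        note eqT = pre_inner_eq[OF T]
        have kw: "represents {w} (\<lambda>_. 1) (\<kappa> w)" using represents_single w by blast
        have "pre_inner ?y ?y = (\<Sum>u\<in>T. \<Sum>v\<in>T. cnj (d u) * d v * k u v)"
          by (simp only: eqT yP represents_inner_double[OF T T])
        then have "0 \<le> pre_inner ?y ?y" using T by (auto simp: represents_def intro: pos)
        also have "pre_inner ?y ?y = t * pre_inner ?y (\<kappa> w) + pre_inner ?y x"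
          unfolding eqT[OF yP] eqT[OF xP] eqT[OF kernel_section_mem[OF w]]
          by (simp add: algebra_simps sum.distrib sum_distrib_left)
        also have "pre_inner ?y (\<kappa> w) = cnj (?y w)"
          using represents_inner_commute[OF T kw] eqT[OF kernel_section_mem[OF w]] by simp
        also have "pre_inner ?y x = cnj (pre_inner x ?y)"
          using represents_inner_commute[OF T S] eqT[OF xP] eq[OF yP] by simp
        also have "pre_inner x ?y = t * pre_inner x (\<kappa> w) + pre_inner x x"
          unfolding eq[OF yP] eq[OF xP] eq[OF kernel_section_mem[OF w]]
          by (simp add: algebra_simps sum.distrib sum_distrib_left)
        also have "pre_inner x (\<kappa> w) = cnj (x w)"
          using represents_inner_commute[OF S kw] eq[OF kernel_section_mem[OF w]] by simp
        finally have "0 \<le> t * cnj (t * k w w + x w) + cnj (t * cnj (x w))"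
          using zero by (simp add: pre_space_def kernel_section_apply w)
        then show ?thesis
          unfolding cmod_power2 by (simp add: complex_nonneg_iff power2_eq_square algebra_simps)
      qed
      have "x w = 0"
      proof (rule ccontr)
        assume nz: "x w \<noteq> 0"
        \<comment> \<open>At \<open>t = - (x w / b)\<close> the quadratic equals
          \<open>- r * (b + 1) / b^2\<close>, which is negative unless \<open>x w\<close> is 0.
          Adding 1 to the diagonal value ensures that \<open>b\<close> can be divided by.\<close>
        define b where "b = Re (k w w) + 1"
        have b: "b \<ge> 1" using diag_nonneg[OF w] by (simp add: b_def complex_nonneg_iff)
        define r where "r = (cmod (x w))\<^sup>2"
        have r: "r > 0" using nz by (simp add: r_def)
        have e1: "Re (- (x w / of_real b) * cnj (x w)) = - r / b"
          unfolding r_def cmod_power2 by (simp add: power2_eq_square add_divide_distrib diff_divide_distrib)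
        have e2: "(cmod (- (x w / of_real b)))\<^sup>2 = r / b\<^sup>2"
          using b by (simp add: r_def norm_divide power_divide)
        have e3: "Re (k w w) = b - 1" by (simp add: b_def)
        have "0 \<le> 2 * (- r / b) + r / b\<^sup>2 * (b - 1)"
          using quad[of "- (x w / of_real b)"] unfolding e1 e2 e3 .
        also have "\<dots> = - (r * (b + 1)) / b\<^sup>2"
          using b by (simp add: power2_eq_square divide_simps algebra_simps)
        also have "\<dots> < 0" using r b by (simp add: divide_simps)
        finally show False by simp
      qed
      then show ?thesis by simp
    qed (use span_vanishes[OF xP] in simp)
  qed
  assume y: "y \<in> hcarrier pre_space"
  then have yP: "y \<in> ?P" by (simp add: pre_space_def)
  then obtain T d where T: "represents T d y" using span_represents by blast
  show "hinner pre_space y x = cnj (hinner pre_space x y)"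
    using represents_inner_commute[OF T S] by (simp add: pre_space_def eq pre_inner_eq[OF T] xP yP)
  show "hinner pre_space x (a *\<^sub>C y) = a * hinner pre_space x y" for a
    by (simp add: pre_space_def eq yP complex_vector.span_scale sum_distrib_left mult.left_commute)
  assume z: "z \<in> hcarrier pre_space"
  then show "hinner pre_space x (y + z) = hinner pre_space x y + hinner pre_space x z"
    using yP by (simp add: pre_space_def eq complex_vector.span_add sum.distrib algebra_simps)
qed

sublocale P: cinner_space pre_space
  by (rule cinner_space_pre_space)

lemma carrier_pre_space: "hcarrier pre_space = cspan (\<kappa> ` \<Omega>)"
  by (simp add: pre_space_def)

lemma pre_space_eval:
  "y \<in> \<Omega> \<Longrightarrow> f \<in> hcarrier pre_space \<Longrightarrow> hinner pre_space (\<kappa> y) f = f y"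
  by (simp add: pre_space_def pre_inner_kernel_section)

lemma kernel_section_pre_space: "y \<in> \<Omega> \<Longrightarrow> \<kappa> y \<in> hcarrier pre_space"
  by (simp add: carrier_pre_space kernel_section_mem)

section \<open>Completion of the span to a space of functions\<close>

definition approximates :: "(nat \<Rightarrow> 'w \<Rightarrow> complex) \<Rightarrow> ('w \<Rightarrow> complex) \<Rightarrow> bool" where
  "approximates \<sigma> f \<longleftrightarrow> hCauchy pre_space \<sigma> \<and> (\<forall>x. (\<lambda>n. \<sigma> n x) \<longlonglongrightarrow> f x)"

lemma approximates_mem: "approximates \<sigma> f \<Longrightarrow> \<sigma> n \<in> hcarrier pre_space"
  using P.hCauchy_mem by (simp add: approximates_def)

lemma approximates_const: "f \<in> hcarrier pre_space \<Longrightarrow> approximates (\<lambda>n. f) f"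
  by (simp add: approximates_def P.hCauchy_const)

lemma approximates_lincomb:
  assumes "approximates \<sigma> f" "approximates \<tau> g"
  shows "approximates (\<lambda>n. \<sigma> n + c *\<^sub>C \<tau> n) (f + c *\<^sub>C g)"
  unfolding approximates_def hCauchy_def
proof (intro conjI allI impI)
  note mem = approximates_mem[OF assms(1)] approximates_mem[OF assms(2)]
  show "range (\<lambda>n. \<sigma> n + c *\<^sub>C \<tau> n) \<subseteq> hcarrier pre_space"
    by (auto intro: P.mem_add P.mem_scaleC mem)
  show "(\<lambda>n. (\<sigma> n + c *\<^sub>C \<tau> n) x) \<longlonglongrightarrow> (f + c *\<^sub>C g) x" for x
    using assms by (auto simp: approximates_def intro!: tendsto_intros)
  fix e :: real assume e: "e > 0"
  define b where "b = cmod c + 1"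
  have b: "b > 0" by (simp add: b_def add_nonneg_pos)
  obtain M where M: "\<And>m n. m \<ge> M \<Longrightarrow> n \<ge> M \<Longrightarrow> hnorm pre_space (\<sigma> m - \<sigma> n) < e / 2"
    using hCauchyD[of pre_space \<sigma> "e / 2"] assms(1) e unfolding approximates_def by fastforce
  obtain N where N: "\<And>m n. m \<ge> N \<Longrightarrow> n \<ge> N \<Longrightarrow> hnorm pre_space (\<tau> m - \<tau> n) < e / 2 / b"
    using hCauchyD[of pre_space \<tau> "e / 2 / b"] assms(2) e b unfolding approximates_def by fastforce
  have "hnorm pre_space ((\<sigma> m + c *\<^sub>C \<tau> m) - (\<sigma> n + c *\<^sub>C \<tau> n)) < e"
    if "m \<ge> max M N" "n \<ge> max M N" for m n
  proof -
    let ?d = "hnorm pre_space (\<tau> m - \<tau> n)"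
    have "cmod c * ?d \<le> b * ?d"
      by (intro mult_right_mono P.hnorm_nonneg P.mem_diff mem) (simp add: b_def)
    also have "\<dots> < e / 2" using N[of m n] that b by (simp add: field_simps)
    finally have small: "hnorm pre_space (c *\<^sub>C (\<tau> m - \<tau> n)) < e / 2"
      by (simp add: P.hnorm_scaleC P.mem_diff mem)
    have eq: "(\<sigma> m + c *\<^sub>C \<tau> m) - (\<sigma> n + c *\<^sub>C \<tau> n) = (\<sigma> m - \<sigma> n) + c *\<^sub>C (\<tau> m - \<tau> n)"
      by (simp add: complex_vector.scale_right_diff_distrib)
    show ?thesis
      using P.hnorm_triangle[of "\<sigma> m - \<sigma> n" "c *\<^sub>C (\<tau> m - \<tau> n)"] M[of m n] that small
      unfolding eq by (simp add: P.mem_diff P.mem_scaleC mem)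
  qed
  then show "\<exists>N. \<forall>m\<ge>N. \<forall>n\<ge>N. hnorm pre_space ((\<sigma> m + c *\<^sub>C \<tau> m) - (\<sigma> n + c *\<^sub>C \<tau> n)) < e"
    by blast
qed

lemma approximates_diff:
  assumes "approximates \<sigma> f" "approximates \<tau> g"
  shows "approximates (\<lambda>n. \<sigma> n - \<tau> n) (f - g)"
  using approximates_lincomb[OF assms, of "-1"]
  by (simp add: complex_vector.scale_minus_left scaleC_one)

text \<open>Against a fixed vector of the span, the inner product is a finite combination of point
  values, so pointwise convergence of \<open>\<sigma>\<close> already controls it.\<close>

lemma pre_inner_tendsto:
  assumes "f \<in> hcarrier pre_space" "\<And>x. (\<lambda>n. \<sigma> n x) \<longlonglongrightarrow> g x" "\<And>n. \<sigma> n \<in> hcarrier pre_space"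
  obtains l where "(\<lambda>n. hinner pre_space f (\<sigma> n)) \<longlonglongrightarrow> l" "(\<And>x. g x = 0) \<Longrightarrow> l = 0"
proof -
  obtain S c where S: "represents S c f"
    using assms(1) span_represents[of f] by (auto simp: carrier_pre_space)
  have eq: "hinner pre_space f (\<sigma> n) = (\<Sum>x\<in>S. cnj (c x) * \<sigma> n x)" for n
    using pre_inner_eq[OF S] assms(3) by (simp add: pre_space_def)
  have "(\<lambda>n. hinner pre_space f (\<sigma> n)) \<longlonglongrightarrow> (\<Sum>x\<in>S. cnj (c x) * g x)"
    unfolding eq by (intro tendsto_intros assms(2))
  then show thesis by (rule that) simp
qed

text \<open>This makes the inner product of the completion independent of the approximating sequences.\<close>

lemma approximates_zero_hnorm:
  assumes "approximates \<sigma> 0"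
  shows "(\<lambda>n. hnorm pre_space (\<sigma> n)) \<longlonglongrightarrow> 0"
proof (rule LIMSEQ_I)
  fix r :: real assume r: "r > 0"
  note mem = approximates_mem[OF assms]
  have C: "hCauchy pre_space \<sigma>" using assms by (simp add: approximates_def)
  obtain B where B: "B > 0" "\<And>n. hnorm pre_space (\<sigma> n) \<le> B"
    using P.hCauchy_bounded[OF C] by blast
  \<comment> \<open>The squared norm of \<open>\<sigma> n\<close> splits into the inner products of
    \<open>\<sigma> n - \<sigma> N\<close> and of \<open>\<sigma> N\<close> with
    \<open>\<sigma> n\<close>. The first is at most \<open>e * B = r^2 / 2\<close>; the second tends
    to 0 because \<open>N\<close> stays fixed.\<close>
  define e where "e = r\<^sup>2 / (2 * B)"
  have e: "e > 0" using r B by (simp add: e_def)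
  obtain N where N: "\<And>m n. m \<ge> N \<Longrightarrow> n \<ge> N \<Longrightarrow> hnorm pre_space (\<sigma> m - \<sigma> n) < e"
    using hCauchyD[OF C e] by blast
  have "(\<lambda>n. hinner pre_space (\<sigma> N) (\<sigma> n)) \<longlonglongrightarrow> 0"
  proof (rule pre_inner_tendsto[OF mem[of N], of \<sigma> 0])
    show "(\<lambda>n. \<sigma> n x) \<longlonglongrightarrow> 0 x" for x
      using assms by (simp add: approximates_def)
  qed (auto simp: mem)
  then have "\<forall>\<^sub>F n in sequentially. cmod (hinner pre_space (\<sigma> N) (\<sigma> n)) < r\<^sup>2 / 2"
    using r by (intro order_tendstoD) (auto intro: tendsto_norm_zero)
  then obtain M where M: "\<And>n. n \<ge> M \<Longrightarrow> cmod (hinner pre_space (\<sigma> N) (\<sigma> n)) < r\<^sup>2 / 2"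
    by (auto simp: eventually_sequentially)
  have "hnorm pre_space (\<sigma> n) < r" if n: "n \<ge> max M N" for n
  proof -
    have "hinner pre_space (\<sigma> n) (\<sigma> n)
        = hinner pre_space (\<sigma> n - \<sigma> N) (\<sigma> n) + hinner pre_space (\<sigma> N) (\<sigma> n)"
      by (simp add: P.inner_diff_left mem)
    then have "(hnorm pre_space (\<sigma> n))\<^sup>2
        \<le> cmod (hinner pre_space (\<sigma> n - \<sigma> N) (\<sigma> n)) + cmod (hinner pre_space (\<sigma> N) (\<sigma> n))"
      using P.inner_self_real[OF mem[of n]] norm_triangle_ineq
      by (metis abs_of_nonneg norm_of_real zero_le_power2)
    also have "cmod (hinner pre_space (\<sigma> n - \<sigma> N) (\<sigma> n)) \<le> e * B"
      using P.Cauchy_Schwarz[OF P.mem_diff[OF mem mem] mem, of n N n] N[of n N] n e B(2)[of n]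
      by (intro order_trans[OF P.Cauchy_Schwarz] mult_mono)
        (auto simp: P.mem_diff mem P.hnorm_nonneg less_imp_le)
    also have "e * B = r\<^sup>2 / 2" using B by (simp add: e_def)
    finally have "(hnorm pre_space (\<sigma> n))\<^sup>2 < r\<^sup>2" using M[of n] n by simp
    then show ?thesis using r by (auto intro: power2_less_imp_less[of _ r])
  qed
  then show "\<exists>n0. \<forall>n\<ge>n0. norm (hnorm pre_space (\<sigma> n) - 0) < r"
    using P.hnorm_nonneg[OF mem] by (intro exI[of _ "max M N"]) (simp del: max.bounded_iff)
qed

lemma inner_approximates_null:
  assumes "hCauchy pre_space \<sigma>" "hCauchy pre_space \<tau>" "(\<lambda>n. hnorm pre_space (\<sigma> n)) \<longlonglongrightarrow> 0"
  shows "(\<lambda>n. hinner pre_space (\<sigma> n) (\<tau> n)) \<longlonglongrightarrow> 0"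
proof -
  obtain B where B: "B > 0" "\<And>n. hnorm pre_space (\<tau> n) \<le> B"
    using P.hCauchy_bounded[OF assms(2)] by blast
  note mem = P.hCauchy_mem[OF assms(1)] P.hCauchy_mem[OF assms(2)]
  show ?thesis
  proof (rule Lim_null_comparison)
    show "\<forall>\<^sub>F n in sequentially.
        norm (hinner pre_space (\<sigma> n) (\<tau> n)) \<le> hnorm pre_space (\<sigma> n) * B"
      by (intro always_eventually allI order_trans[OF P.Cauchy_Schwarz] mult_left_mono)
        (auto simp: mem B P.hnorm_nonneg)
    show "(\<lambda>n. hnorm pre_space (\<sigma> n) * B) \<longlonglongrightarrow> 0"
      using assms(3) by (rule tendsto_mult_left_zero)
  qed
qed

lemma inner_Cauchy_convergent:
  assumes \<sigma>: "hCauchy pre_space \<sigma>" and \<tau>: "hCauchy pre_space \<tau>"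
  shows "convergent (\<lambda>n. hinner pre_space (\<sigma> n) (\<tau> n))"
proof (rule Cauchy_convergent, rule CauchyI)
  fix e :: real assume e: "e > 0"
  obtain B where B: "B > 0" "\<And>n. hnorm pre_space (\<sigma> n) \<le> B"
    using P.hCauchy_bounded[OF \<sigma>] by blast
  obtain C where C: "C > 0" "\<And>n. hnorm pre_space (\<tau> n) \<le> C"
    using P.hCauchy_bounded[OF \<tau>] by blast
  note mem = P.hCauchy_mem[OF \<sigma>] P.hCauchy_mem[OF \<tau>]
  obtain M where M: "\<And>m n. m \<ge> M \<Longrightarrow> n \<ge> M \<Longrightarrow> hnorm pre_space (\<sigma> m - \<sigma> n) < e / 2 / C"
    using hCauchyD[OF \<sigma>, of "e / 2 / C"] e C by fastforce
  obtain N where N: "\<And>m n. m \<ge> N \<Longrightarrow> n \<ge> N \<Longrightarrow> hnorm pre_space (\<tau> m - \<tau> n) < e / 2 / B"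
    using hCauchyD[OF \<tau>, of "e / 2 / B"] e B by fastforce
  have "cmod (hinner pre_space (\<sigma> m) (\<tau> m) - hinner pre_space (\<sigma> n) (\<tau> n)) < e"
    if "m \<ge> max M N" "n \<ge> max M N" for m n
  proof -
    have "hinner pre_space (\<sigma> m) (\<tau> m) - hinner pre_space (\<sigma> n) (\<tau> n)
        = hinner pre_space (\<sigma> m - \<sigma> n) (\<tau> m) + hinner pre_space (\<sigma> n) (\<tau> m - \<tau> n)"
      by (simp add: P.inner_diff P.inner_diff_left mem)
    then have "cmod (hinner pre_space (\<sigma> m) (\<tau> m) - hinner pre_space (\<sigma> n) (\<tau> n))
        \<le> hnorm pre_space (\<sigma> m - \<sigma> n) * hnorm pre_space (\<tau> m)
          + hnorm pre_space (\<sigma> n) * hnorm pre_space (\<tau> m - \<tau> n)"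
      using norm_triangle_ineq[of "hinner pre_space (\<sigma> m - \<sigma> n) (\<tau> m)"
          "hinner pre_space (\<sigma> n) (\<tau> m - \<tau> n)"]
        P.Cauchy_Schwarz[OF P.mem_diff[OF mem(1) mem(1)] mem(2), of m n m]
        P.Cauchy_Schwarz[OF mem(1) P.mem_diff[OF mem(2) mem(2)], of n m n] by simp
    also have "\<dots> \<le> hnorm pre_space (\<sigma> m - \<sigma> n) * C + B * hnorm pre_space (\<tau> m - \<tau> n)"
      by (intro add_mono mult_left_mono mult_right_mono P.hnorm_nonneg P.mem_diff mem B C)
    also have "\<dots> < e / 2 + e / 2"
      using M[of m n] N[of m n] that B C by (intro add_strict_mono) (auto simp: field_simps)
    finally show ?thesis by simp
  qed
  then show "\<exists>M. \<forall>m\<ge>M. \<forall>n\<ge>M. norm (hinner pre_space (\<sigma> m) (\<tau> m) - hinner pre_space (\<sigma> n) (\<tau> n)) < e"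
    by blast
qed

text \<open>The approximating sequences are picked arbitrarily; \<open>rkhs_inner_tendsto\<close>
  replaces them by any others, and all later arguments go through it.\<close>

definition rkhs :: "('w \<Rightarrow> complex) hspace" where
  "rkhs = \<lparr>hcarrier = {f. \<exists>\<sigma>. approximates \<sigma> f},
    hinner = (\<lambda>f g. lim (\<lambda>n. hinner pre_space ((SOME \<sigma>. approximates \<sigma> f) n)
      ((SOME \<sigma>. approximates \<sigma> g) n)))\<rparr>"

lemma carrier_rkhs: "f \<in> hcarrier rkhs \<longleftrightarrow> (\<exists>\<sigma>. approximates \<sigma> f)"
  by (simp add: rkhs_def)

text \<open>Exchanging the chosen sequences for the given ones, one argument at a time, costs two
  inner products in which one factor is a norm-null sequence. The second appears conjugated so that
  its null factor comes first, as \<open>inner_approximates_null\<close> expects.\<close>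

lemma rkhs_inner_tendsto:
  assumes f: "approximates \<sigma> f" and g: "approximates \<tau> g"
  shows "(\<lambda>n. hinner pre_space (\<sigma> n) (\<tau> n)) \<longlonglongrightarrow> hinner rkhs f g"
proof -
  define \<sigma>' where "\<sigma>' = (SOME \<sigma>. approximates \<sigma> f)"
  define \<tau>' where "\<tau>' = (SOME \<sigma>. approximates \<sigma> g)"
  have \<sigma>': "approximates \<sigma>' f" unfolding \<sigma>'_def by (rule someI[of "\<lambda>\<sigma>. approximates \<sigma> f", OF f])
  have \<tau>': "approximates \<tau>' g" unfolding \<tau>'_def by (rule someI[of "\<lambda>\<sigma>. approximates \<sigma> g", OF g])
  note mem = approximates_mem[OF f] approximates_mem[OF g] approximates_mem[OF \<sigma>'] approximates_mem[OF \<tau>']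
  have Cauchy: "hCauchy pre_space \<sigma>" "hCauchy pre_space \<tau>'" "hCauchy pre_space \<tau>" "hCauchy pre_space \<sigma>'"
    using f \<tau>' g \<sigma>' by (auto simp: approximates_def)
  have d1: "approximates (\<lambda>n. \<sigma> n - \<sigma>' n) 0" and d2: "approximates (\<lambda>n. \<tau> n - \<tau>' n) 0"
    using approximates_diff[OF f \<sigma>'] approximates_diff[OF g \<tau>'] by simp_all
  have "(\<lambda>n. hinner pre_space (\<sigma> n - \<sigma>' n) (\<tau>' n)) \<longlonglongrightarrow> 0"
    using d1 approximates_zero_hnorm[OF d1] Cauchy
    by (intro inner_approximates_null) (auto simp: approximates_def)
  moreover have "(\<lambda>n. cnj (hinner pre_space (\<tau> n - \<tau>' n) (\<sigma> n))) \<longlonglongrightarrow> cnj 0"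
    using d2 approximates_zero_hnorm[OF d2] Cauchy
    by (intro tendsto_cnj inner_approximates_null) (auto simp: approximates_def)
  moreover have "(\<lambda>n. hinner pre_space (\<sigma>' n) (\<tau>' n)) \<longlonglongrightarrow> hinner rkhs f g"
    using inner_Cauchy_convergent[OF Cauchy(4,2)]
    by (simp add: rkhs_def \<sigma>'_def \<tau>'_def convergent_LIMSEQ_iff)
  ultimately have "(\<lambda>n. hinner pre_space (\<sigma> n - \<sigma>' n) (\<tau>' n)
      + cnj (hinner pre_space (\<tau> n - \<tau>' n) (\<sigma> n)) + hinner pre_space (\<sigma>' n) (\<tau>' n))
      \<longlonglongrightarrow> 0 + cnj 0 + hinner rkhs f g"
    by (intro tendsto_add)
  moreover have "hinner pre_space (\<sigma> n - \<sigma>' n) (\<tau>' n) + cnj (hinner pre_space (\<tau> n - \<tau>' n) (\<sigma> n))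
      + hinner pre_space (\<sigma>' n) (\<tau>' n) = hinner pre_space (\<sigma> n) (\<tau> n)" for n
    using P.inner_commute[OF mem(2) mem(1), of n n] P.inner_commute[OF mem(4) mem(1), of n n]
    by (simp add: P.inner_diff P.inner_diff_left mem P.mem_diff)
  ultimately show ?thesis by simp
qed

lemma rkhs_inner_pre_space:
  assumes "f \<in> hcarrier pre_space" "g \<in> hcarrier pre_space"
  shows "hinner rkhs f g = hinner pre_space f g"
  using rkhs_inner_tendsto[OF approximates_const approximates_const, OF assms] by (simp add: LIMSEQ_const_iff)

lemma rkhs_hnorm_pre_space: "f \<in> hcarrier pre_space \<Longrightarrow> hnorm rkhs f = hnorm pre_space f"
  by (simp add: hnorm_def rkhs_inner_pre_space)

lemma pre_space_subset_rkhs: "f \<in> hcarrier pre_space \<Longrightarrow> f \<in> hcarrier rkhs"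
  using approximates_const by (auto simp: carrier_rkhs)

lemma rkhs_eval:
  assumes "y \<in> \<Omega>" "f \<in> hcarrier rkhs"
  shows "hinner rkhs (\<kappa> y) f = f y"
proof -
  obtain \<sigma> where \<sigma>: "approximates \<sigma> f" using assms(2) carrier_rkhs by blast
  have "(\<lambda>n. \<sigma> n y) \<longlonglongrightarrow> hinner rkhs (\<kappa> y) f"
    using rkhs_inner_tendsto[OF approximates_const[OF kernel_section_pre_space[OF assms(1)]] \<sigma>]
    by (simp add: pre_space_eval[OF assms(1) approximates_mem[OF \<sigma>]])
  moreover have "(\<lambda>n. \<sigma> n y) \<longlonglongrightarrow> f y" using \<sigma> by (simp add: approximates_def)
  ultimately show ?thesis by (rule LIMSEQ_unique)
qed

lemma rkhs_vanishes:
  assumes "f \<in> hcarrier rkhs" "x \<notin> \<Omega>"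
  shows "f x = 0"
proof -
  obtain \<sigma> where \<sigma>: "approximates \<sigma> f" using assms(1) carrier_rkhs by blast
  have "\<sigma> n x = 0" for n
    using span_vanishes[OF _ assms(2)] approximates_mem[OF \<sigma>] by (simp add: carrier_pre_space)
  moreover have "(\<lambda>n. \<sigma> n x) \<longlonglongrightarrow> f x" using \<sigma> by (simp add: approximates_def)
  ultimately show ?thesis using LIMSEQ_const_iff[of 0 "f x"] by simp
qed

lemma rkhs_lincomb:
  assumes "f \<in> hcarrier rkhs" "g \<in> hcarrier rkhs"
  shows "f + c *\<^sub>C g \<in> hcarrier rkhs"
  using assms unfolding carrier_rkhs by (blast intro: approximates_lincomb)

lemma cinner_space_rkhs: "cinner_space rkhs"
proof
  have zero: "0 \<in> hcarrier rkhs" using pre_space_subset_rkhs P.mem_zero by blast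
  show "csubspace (hcarrier rkhs)"
    unfolding complex_vector.subspace_def
    using rkhs_lincomb[of _ _ 1] rkhs_lincomb[OF zero] zero by (simp add: scaleC_one)
  fix f g h
  assume "f \<in> hcarrier rkhs"
  then obtain \<sigma> where \<sigma>: "approximates \<sigma> f" using carrier_rkhs by blast
  have lim: "(\<lambda>n. complex_of_real ((hnorm pre_space (\<sigma> n))\<^sup>2)) \<longlonglongrightarrow> hinner rkhs f f"
    using rkhs_inner_tendsto[OF \<sigma> \<sigma>] by (simp add: P.inner_self_real approximates_mem[OF \<sigma>])
  then have "(\<lambda>n. (hnorm pre_space (\<sigma> n))\<^sup>2) \<longlonglongrightarrow> Re (hinner rkhs f f)"
    "(\<lambda>n. 0) \<longlonglongrightarrow> Im (hinner rkhs f f)"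
    using tendsto_Re[OF lim] tendsto_Im[OF lim] by simp_all
  then show "0 \<le> hinner rkhs f f"
    using LIMSEQ_const_iff[of 0 "Im (hinner rkhs f f)"]
    by (auto simp: complex_nonneg_iff intro: LIMSEQ_le_const)
  \<comment> \<open>Norms tending to 0 force the inner products with every kernel section, that is
    the point values, to tend to 0; these values also converge to \<open>f\<close>.\<close>
  show "f = 0" if zero: "hinner rkhs f f = 0"
  proof
    have "(\<lambda>n. hnorm pre_space (\<sigma> n)) \<longlonglongrightarrow> 0"
      using tendsto_real_sqrt[OF tendsto_Re[OF lim]] zero
      by (simp add: P.hnorm_nonneg approximates_mem[OF \<sigma>])
    then have "(\<lambda>n. hinner pre_space (\<sigma> n) (\<kappa> x)) \<longlonglongrightarrow> 0" if "x \<in> \<Omega>" for x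
      using \<sigma> P.hCauchy_const[OF kernel_section_pre_space[OF that]]
      by (intro inner_approximates_null) (auto simp: approximates_def)
    then have "(\<lambda>n. \<sigma> n x) \<longlonglongrightarrow> 0" if "x \<in> \<Omega>" for x
      using tendsto_cnj[of "\<lambda>n. hinner pre_space (\<sigma> n) (\<kappa> x)" 0] that
        P.inner_commute[OF approximates_mem[OF \<sigma>] kernel_section_pre_space[OF that]]
        pre_space_eval[OF that approximates_mem[OF \<sigma>]]
      by simp
    moreover have "(\<lambda>n. \<sigma> n x) \<longlonglongrightarrow> f x" for x using \<sigma> by (simp add: approximates_def)
    ultimately show "f x = 0 x" for x
      using rkhs_vanishes[OF \<open>f \<in> hcarrier rkhs\<close>, of x] LIMSEQ_unique
      by (cases "x \<in> \<Omega>") fastforce+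
  qed
  assume "g \<in> hcarrier rkhs"
  then obtain \<tau> where \<tau>: "approximates \<tau> g" using carrier_rkhs by blast
  note mem = approximates_mem[OF \<sigma>] approximates_mem[OF \<tau>]
  have "(\<lambda>n. hinner pre_space (\<tau> n) (\<sigma> n)) \<longlonglongrightarrow> cnj (hinner rkhs f g)"
    using tendsto_cnj[OF rkhs_inner_tendsto[OF \<sigma> \<tau>]] P.inner_commute[OF mem] by simp
  then show "hinner rkhs g f = cnj (hinner rkhs f g)"
    using rkhs_inner_tendsto[OF \<tau> \<sigma>] LIMSEQ_unique by blast
  show "hinner rkhs f (c *\<^sub>C g) = c * hinner rkhs f g" for c
  proof -
    have "approximates (\<lambda>n. c *\<^sub>C \<tau> n) (c *\<^sub>C g)"
      using approximates_lincomb[OF approximates_const[OF P.mem_zero] \<tau>] by simp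
    then have "(\<lambda>n. c * hinner pre_space (\<sigma> n) (\<tau> n)) \<longlonglongrightarrow> hinner rkhs f (c *\<^sub>C g)"
      using rkhs_inner_tendsto[OF \<sigma>] P.inner_scaleC[OF mem] by fastforce
    moreover have "(\<lambda>n. c * hinner pre_space (\<sigma> n) (\<tau> n)) \<longlonglongrightarrow> c * hinner rkhs f g"
      by (intro tendsto_mult_left rkhs_inner_tendsto \<sigma> \<tau>)
    ultimately show ?thesis by (rule LIMSEQ_unique)
  qed
  assume "h \<in> hcarrier rkhs"
  then obtain \<upsilon> where \<upsilon>: "approximates \<upsilon> h" using carrier_rkhs by blast
  have "approximates (\<lambda>n. \<tau> n + \<upsilon> n) (g + h)"
    using approximates_lincomb[OF \<tau> \<upsilon>, of 1] by (simp add: scaleC_one)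
  then have "(\<lambda>n. hinner pre_space (\<sigma> n) (\<tau> n) + hinner pre_space (\<sigma> n) (\<upsilon> n))
      \<longlonglongrightarrow> hinner rkhs f (g + h)"
    using rkhs_inner_tendsto[OF \<sigma>] P.inner_add[OF mem approximates_mem[OF \<upsilon>]] by fastforce
  moreover have "(\<lambda>n. hinner pre_space (\<sigma> n) (\<tau> n) + hinner pre_space (\<sigma> n) (\<upsilon> n))
      \<longlonglongrightarrow> hinner rkhs f g + hinner rkhs f h"
    by (intro tendsto_add rkhs_inner_tendsto \<sigma> \<tau> \<upsilon>)
  ultimately show "hinner rkhs f (g + h) = hinner rkhs f g + hinner rkhs f h"
    by (rule LIMSEQ_unique)
qed

sublocale F: cinner_space rkhs
  by (rule cinner_space_rkhs)

lemma rkhs_hnorm_tendsto: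
  assumes "approximates \<sigma> f"
  shows "(\<lambda>n. hnorm pre_space (\<sigma> n)) \<longlonglongrightarrow> hnorm rkhs f"
  unfolding hnorm_def by (intro tendsto_real_sqrt tendsto_Re rkhs_inner_tendsto assms)

text \<open>The distance from \<open>\<sigma> n\<close> to the pointwise limit is the limit over
  \<open>m\<close> of the distances from \<open>\<sigma> n\<close> to \<open>\<sigma> m\<close>,
  which the Cauchy condition bounds. In particular the span is dense in \<open>rkhs\<close>.\<close>

lemma approximates_hconverges:
  assumes \<sigma>: "approximates \<sigma> f"
  shows "hconverges rkhs \<sigma> f"
  unfolding hconverges_def
proof (intro conjI)
  note mem = approximates_mem[OF \<sigma>]
  show "range \<sigma> \<subseteq> hcarrier rkhs" using mem pre_space_subset_rkhs by blast
  show f: "f \<in> hcarrier rkhs" using \<sigma> carrier_rkhs by blast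
  show "(\<lambda>n. hnorm rkhs (\<sigma> n - f)) \<longlonglongrightarrow> 0"
  proof (rule LIMSEQ_I)
    fix e :: real assume e: "e > 0"
    obtain N where N: "\<And>m n. m \<ge> N \<Longrightarrow> n \<ge> N \<Longrightarrow> hnorm pre_space (\<sigma> m - \<sigma> n) < e / 2"
      using hCauchyD[of pre_space \<sigma> "e / 2"] \<sigma> e unfolding approximates_def by fastforce
    have "hnorm rkhs (\<sigma> n - f) < e" if n: "n \<ge> N" for n
    proof -
      have "(\<lambda>m. hnorm pre_space (\<sigma> n - \<sigma> m)) \<longlonglongrightarrow> hnorm rkhs (\<sigma> n - f)"
        by (intro rkhs_hnorm_tendsto approximates_diff approximates_const mem \<sigma>)
      then have "hnorm rkhs (\<sigma> n - f) \<le> e / 2"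
        using N[OF n] by (intro LIMSEQ_le_const2[of _ _ "e / 2"]) (auto intro: less_imp_le)
      then show ?thesis using e by simp
    qed
    then show "\<exists>N. \<forall>n\<ge>N. norm (hnorm rkhs (\<sigma> n - f) - 0) < e"
      using F.hnorm_nonneg F.mem_diff pre_space_subset_rkhs[OF mem] f by (intro exI[of _ N]) simp
  qed
qed

text \<open>Each \<open>\<sigma> n\<close> is replaced by a vector \<open>p n\<close> of the span at
  distance below \<open>1 / Suc n\<close>. The sequence \<open>p\<close> is again Cauchy and
  converges pointwise, its values being inner products with sections; so its pointwise limit lies in
  the space by construction, and \<open>\<sigma>\<close> has the same limit.\<close>

lemma hilbert_space_rkhs: "hilbert_space rkhs"
proof (rule F.hilbert_spaceI)
  fix \<sigma> assume \<sigma>: "hCauchy rkhs \<sigma>"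
  note mem = F.hCauchy_mem[OF \<sigma>]
  have "\<exists>p. p \<in> hcarrier pre_space \<and> hnorm rkhs (\<sigma> n - p) < 1 / real (Suc n)" for n
  proof -
    obtain \<tau> where \<tau>: "approximates \<tau> (\<sigma> n)" using mem carrier_rkhs by blast
    have "\<forall>\<^sub>F m in sequentially. hnorm rkhs (\<tau> m - \<sigma> n) < 1 / real (Suc n)"
      using approximates_hconverges[OF \<tau>] by (intro order_tendstoD) (auto simp: hconverges_def)
    then obtain m where "hnorm rkhs (\<tau> m - \<sigma> n) < 1 / real (Suc n)"
      by (auto simp: eventually_sequentially)
    then show ?thesis
      using approximates_mem[OF \<tau>] F.hnorm_minus[OF mem pre_space_subset_rkhs[OF approximates_mem[OF \<tau>]]]
      by metis
  qed
  then obtain p where p: "\<And>n. p n \<in> hcarrier pre_space"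
    and close: "\<And>n. hnorm rkhs (\<sigma> n - p n) < 1 / real (Suc n)"
    by metis
  have pF: "p n \<in> hcarrier rkhs" for n using p pre_space_subset_rkhs by blast
  have lim0: "(\<lambda>n. hnorm rkhs (\<sigma> n - p n)) \<longlonglongrightarrow> 0"
    by (intro Lim_null_comparison[OF _ LIMSEQ_Suc[OF lim_1_over_n]])
      (use close F.hnorm_nonneg F.mem_diff[OF mem pF] in \<open>auto intro!: always_eventually less_imp_le simp del: of_nat_Suc\<close>)
  have pC: "hCauchy pre_space p"
    unfolding hCauchy_def
  proof (intro conjI allI impI)
    show "range p \<subseteq> hcarrier pre_space" using p by blast
    fix e :: real assume e: "e > 0"
    obtain N where N: "\<And>m n. m \<ge> N \<Longrightarrow> n \<ge> N \<Longrightarrow> hnorm rkhs (\<sigma> m - \<sigma> n) < e / 3"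
      using hCauchyD[OF \<sigma>, of "e / 3"] e by fastforce
    have "\<forall>\<^sub>F n in sequentially. hnorm rkhs (\<sigma> n - p n) < e / 3"
      using lim0 e by (intro order_tendstoD) auto
    then obtain M where M: "\<And>n. n \<ge> M \<Longrightarrow> hnorm rkhs (\<sigma> n - p n) < e / 3"
      by (auto simp: eventually_sequentially)
    have "hnorm pre_space (p m - p n) < e" if "m \<ge> max M N" "n \<ge> max M N" for m n
    proof -
      have "hnorm rkhs (p m - p n) \<le> hnorm rkhs (\<sigma> m - p m) + hnorm rkhs (\<sigma> m - \<sigma> n) + hnorm rkhs (\<sigma> n - p n)"
        using F.hnorm_diff_triangle[OF pF mem pF, of m n m] F.hnorm_diff_triangle[OF mem mem pF, of m n n]
          F.hnorm_minus[OF mem pF, of m m] by simp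
      then show ?thesis
        using M[of m] M[of n] N[of m n] that by (simp add: rkhs_hnorm_pre_space P.mem_diff p)
    qed
    then show "\<exists>N. \<forall>m\<ge>N. \<forall>n\<ge>N. hnorm pre_space (p m - p n) < e" by blast
  qed
  have "convergent (\<lambda>n. p n x)" for x
  proof (cases "x \<in> \<Omega>")
    case True
    then show ?thesis
      using inner_Cauchy_convergent[OF P.hCauchy_const[OF kernel_section_pre_space[OF True]] pC]
      by (simp add: pre_space_eval p)
  next
    case False
    then have "p n x = 0" for n using span_vanishes p by (simp add: carrier_pre_space)
    then show ?thesis by (simp add: convergent_const)
  qed
  then have pf: "approximates p (\<lambda>x. lim (\<lambda>n. p n x))"
    using pC by (simp add: approximates_def convergent_LIMSEQ_iff)
  define f where "f = (\<lambda>x. lim (\<lambda>n. p n x))"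
  have p_lim: "hconverges rkhs p f" unfolding f_def by (rule approximates_hconverges[OF pf])
  then have f: "f \<in> hcarrier rkhs" by (simp add: hconverges_def)
  have "(\<lambda>n. hnorm rkhs (\<sigma> n - f)) \<longlonglongrightarrow> 0"
  proof (rule Lim_null_comparison)
    show "\<forall>\<^sub>F n in sequentially.
        norm (hnorm rkhs (\<sigma> n - f)) \<le> hnorm rkhs (\<sigma> n - p n) + hnorm rkhs (p n - f)"
      using F.hnorm_diff_triangle[OF mem pF f] F.hnorm_nonneg[OF F.mem_diff[OF mem f]]
      by (intro always_eventually allI) simp
    show "(\<lambda>n. hnorm rkhs (\<sigma> n - p n) + hnorm rkhs (p n - f)) \<longlonglongrightarrow> 0"
      using tendsto_add[OF lim0] p_lim by (fastforce simp: hconverges_def)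
  qed
  then show "\<exists>f. hconverges rkhs \<sigma> f"
    using mem f by (auto simp: hconverges_def)
qed

lemma is_rkhs_rkhs: "is_rkhs \<Omega> k rkhs"
  unfolding is_rkhs_def
  using hilbert_space_rkhs rkhs_vanishes rkhs_eval kernel_section_pre_space pre_space_subset_rkhs by metis

lemma rkhs_dense:
  assumes "f \<in> hcarrier rkhs"
  obtains \<sigma> where "range \<sigma> \<subseteq> cspan (\<kappa> ` \<Omega>)" "hconverges rkhs \<sigma> f"
proof -
  obtain \<sigma> where \<sigma>: "approximates \<sigma> f" using assms carrier_rkhs by blast
  show thesis
    using that[OF _ approximates_hconverges[OF \<sigma>]] approximates_mem[OF \<sigma>]
    by (auto simp: carrier_pre_space)
qed

end

section \<open>Minimal factorizations\<close>

lemma is_rkhs_hilbert_space: "is_rkhs \<Omega> k F \<Longrightarrow> hilbert_space F"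
  by (simp add: is_rkhs_def)

text \<open>Evaluation is the inner product with a kernel section, hence continuous. This is how
  norm limits are later identified with functions given by formulas.\<close>

lemma rkhs_hconverges_pointwise:
  assumes F: "is_rkhs \<Omega> k F" and lim: "hconverges F \<sigma> f"
  shows "(\<lambda>n. \<sigma> n w) \<longlonglongrightarrow> f w"
proof (cases "w \<in> \<Omega>")
  case True
  interpret F: hilbert_space F using F by (rule is_rkhs_hilbert_space)
  have "(\<lambda>n. hinner F (kernel_section \<Omega> k w) (\<sigma> n)) \<longlonglongrightarrow> hinner F (kernel_section \<Omega> k w) f"
    using F True by (intro F.hconverges_inner lim) (simp add: is_rkhs_def)
  then show ?thesis
    using F F.hconverges_mem[OF lim] True by (simp add: is_rkhs_def)
next
  case False
  interpret F: hilbert_space F using F by (rule is_rkhs_hilbert_space)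
  have "g w = 0" if "g \<in> hcarrier F" for g
    using F that False by (simp add: is_rkhs_def)
  then have "\<sigma> n w = 0" "f w = 0" for n
    using F.hconverges_mem[OF lim] by blast+
  then show ?thesis by simp
qed

text \<open>A total family with Gram matrix \<open>k\<close> determines the Hilbert space: the map
  sends \<open>\<phi> w\<close> to the kernel section at \<open>w\<close>. Its values lie in
  \<open>F\<close> for vectors of the span by linearity, and for all others by
  approximation.\<close>

lemma unitary_onto_rkhs:
  assumes L: "hilbert_space L" and F: "is_rkhs \<Omega> k F"
    and \<phi>: "\<And>w. w \<in> \<Omega> \<Longrightarrow> \<phi> w \<in> hcarrier L"
    and gram: "\<And>x y. x \<in> \<Omega> \<Longrightarrow> y \<in> \<Omega> \<Longrightarrow> hinner L (\<phi> x) (\<phi> y) = k x y"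
    and total: "hcarrier L = closed_span L (\<phi> ` \<Omega>)"
  shows "(\<lambda>x w. if w \<in> \<Omega> then hinner L (\<phi> w) x else 0) \<in> unitary_operators L F"
proof -
  interpret L: hilbert_space L by fact
  interpret F: hilbert_space F using F by (rule is_rkhs_hilbert_space)
  define W where "W x w = (if w \<in> \<Omega> then hinner L (\<phi> w) x else 0)" for x w
  let ?\<kappa> = "kernel_section \<Omega> k"
  have \<kappa>: "?\<kappa> w \<in> hcarrier F" if "w \<in> \<Omega>" for w
    using F that by (simp add: is_rkhs_def)
  have eval: "hinner F (?\<kappa> w) f = f w" if "w \<in> \<Omega>" "f \<in> hcarrier F" for w f
    using F that by (simp add: is_rkhs_def)
  have vanish: "f w = 0" if "w \<notin> \<Omega>" "f \<in> hcarrier F" for w f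
    using F that by (simp add: is_rkhs_def)
  have sub: "\<phi> ` \<Omega> \<subseteq> hcarrier L" using \<phi> by blast
  note span_mem = L.mem_cspan[OF sub]
  have W_add: "W (x + y) = W x + W y" if "x \<in> hcarrier L" "y \<in> hcarrier L" for x y
    using that by (auto simp: fun_eq_iff W_def L.inner_add \<phi>)
  have W_scale: "W (c *\<^sub>C x) = c *\<^sub>C W x" if "x \<in> hcarrier L" for c x
    using that by (auto simp: fun_eq_iff W_def L.inner_scaleC \<phi>)
  have W_diff: "W (x - y) = W x - W y" if "x \<in> hcarrier L" "y \<in> hcarrier L" for x y
    using that by (auto simp: fun_eq_iff W_def L.inner_diff \<phi>)
  have W_\<phi>: "W (\<phi> w) = ?\<kappa> w" if "w \<in> \<Omega>" for w
    using that by (auto simp: fun_eq_iff W_def kernel_section_def gram)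
  have W_zero: "W 0 = 0"
    by (auto simp: fun_eq_iff W_def L.inner_zero_right \<phi>)
  \<comment> \<open>From here on, functions are treated as vectors; unfolding the operations
    pointwise would hide the sums and multiples from the rules about \<open>F\<close>.\<close>
  note [simp del] = plus_fun_apply zero_fun_apply scaleC_fun_apply
  have W_span: "W x \<in> hcarrier F" if "x \<in> cspan (\<phi> ` \<Omega>)" for x
  proof -
    have "x \<in> hcarrier L \<and> W x \<in> hcarrier F"
      using that
    proof (induction rule: complex_vector.span_induct_alt)
      case base
      show ?case unfolding W_zero using F.mem_zero L.mem_zero by blast
    next
      case (step c x y)
      then have "x \<in> hcarrier L" "W x \<in> hcarrier F" using \<phi> \<kappa> W_\<phi> by auto
      then show ?case
        using step by (simp add: W_add W_scale L.mem_add L.mem_scaleC F.mem_add F.mem_scaleC)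
    qed
    then show ?thesis ..
  qed
  \<comment> \<open>For \<open>x = \<phi> w\<close> the left side is the reproducing property: it
    evaluates \<open>W y\<close> at \<open>w\<close>, which is the right side by the definition of
    \<open>W\<close>. Linearity handles the rest of the span; \<open>y\<close> may be any vector
    whose image is already known to lie in \<open>F\<close>.\<close>
  have iso_span: "hinner F (W x) (W y) = hinner L x y"
    if "x \<in> cspan (\<phi> ` \<Omega>)" and y: "y \<in> hcarrier L" "W y \<in> hcarrier F" for x y
  proof -
    have "x \<in> hcarrier L \<and> W x \<in> hcarrier F \<and> hinner F (W x) (W y) = hinner L x y"
      using that(1)
    proof (induction rule: complex_vector.span_induct_alt)
      case base
      show ?case unfolding W_zero F.inner_zero_left[OF y(2)] L.inner_zero_left[OF y(1)]
        using F.mem_zero L.mem_zero by blast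
    next
      case (step c x z)
      then obtain w where w: "w \<in> \<Omega>" "x = \<phi> w" by blast
      then have x: "x \<in> hcarrier L" "W x \<in> hcarrier F" using \<phi> \<kappa> W_\<phi> by auto
      have "hinner F (W x) (W y) = hinner L x y"
        using w y by (simp add: W_\<phi> eval) (simp add: W_def)
      then show ?case
        using step x y by (simp add: W_add W_scale L.mem_add L.mem_scaleC F.mem_add F.mem_scaleC
            F.inner_add_left F.inner_scaleC_left L.inner_add_left L.inner_scaleC_left)
    qed
    then show ?thesis by blast
  qed
  have W_lim: "W x \<in> hcarrier F \<and> (\<exists>\<sigma>. range \<sigma> \<subseteq> cspan (\<phi> ` \<Omega>) \<and> hconverges L \<sigma> x
      \<and> hconverges F (\<lambda>n. W (\<sigma> n)) (W x))" if x: "x \<in> hcarrier L" for x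
  proof -
    have "x \<in> closed_span L (\<phi> ` \<Omega>)" using x total by blast
    then obtain \<sigma> where \<sigma>: "range \<sigma> \<subseteq> cspan (\<phi> ` \<Omega>)" and lim: "hconverges L \<sigma> x"
      by (rule L.closed_span_hconverges[OF sub])
    have span: "\<sigma> n \<in> cspan (\<phi> ` \<Omega>)" for n using \<sigma> by blast
    note mem = L.hconverges_mem[OF lim]
    have hnorm: "hnorm F (W (\<sigma> m) - W (\<sigma> n)) = hnorm L (\<sigma> m - \<sigma> n)" for m n
    proof -
      have d: "\<sigma> m - \<sigma> n \<in> cspan (\<phi> ` \<Omega>)" using span by (intro complex_vector.span_diff)
      show ?thesis
        unfolding W_diff[OF mem(1) mem(1), symmetric] hnorm_def
        by (simp add: iso_span[OF d span_mem[OF d] W_span[OF d]])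
    qed
    have "hCauchy F (\<lambda>n. W (\<sigma> n))"
      using L.hconverges_imp_hCauchy[OF lim] W_span span by (auto simp: hCauchy_def hnorm)
    then obtain f where f: "hconverges F (\<lambda>n. W (\<sigma> n)) f" by (rule F.hCauchy_imp_hconverges)
    \<comment> \<open>The limit \<open>f\<close> comes from completeness of \<open>F\<close> and is
      identified with \<open>W x\<close> through its values.\<close>
    have "f w = W x w" for w
    proof (cases "w \<in> \<Omega>")
      case True
      have "(\<lambda>n. W (\<sigma> n) w) \<longlonglongrightarrow> f w" by (rule rkhs_hconverges_pointwise[OF F f])
      moreover have "(\<lambda>n. W (\<sigma> n) w) \<longlonglongrightarrow> W x w"
        using L.hconverges_inner[OF lim \<phi>[OF True]] True by (simp add: W_def)
      ultimately show ?thesis by (rule LIMSEQ_unique)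
    next
      case False
      then show ?thesis using vanish F.hconverges_mem(2)[OF f] by (simp add: W_def)
    qed
    then have "f = W x" by blast
    then show ?thesis using f F.hconverges_mem(2)[OF f] \<sigma> lim by blast
  qed
  then have W_mem: "W x \<in> hcarrier F" if "x \<in> hcarrier L" for x using that by blast
  have iso: "hinner F (W x) (W y) = hinner L x y" if x: "x \<in> hcarrier L" and y: "y \<in> hcarrier L" for x y
  proof -
    obtain \<sigma> where \<sigma>: "range \<sigma> \<subseteq> cspan (\<phi> ` \<Omega>)" and lim: "hconverges L \<sigma> x"
      and W\<sigma>: "hconverges F (\<lambda>n. W (\<sigma> n)) (W x)"
      using W_lim[OF x] by blast
    have "hinner F (W (\<sigma> n)) (W y) = hinner L (\<sigma> n) y" for n
      using \<sigma> by (intro iso_span y W_mem) blast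
    then have "(\<lambda>n. hinner L (\<sigma> n) y) \<longlonglongrightarrow> hinner F (W x) (W y)"
      using F.hconverges_inner_left[OF W\<sigma> W_mem[OF y]] by simp
    then show ?thesis using L.hconverges_inner_left[OF lim y] by (rule LIMSEQ_unique)
  qed
  have hnorm_W: "hnorm F (W x) = hnorm L x" if "x \<in> hcarrier L" for x
    using iso[OF that that] by (simp add: hnorm_def)
  have "\<exists>z\<in>hcarrier L. W z = f" if f: "f \<in> hcarrier F" for f
  proof -
    \<comment> \<open>The vector \<open>z\<close> is the adjoint of \<open>W\<close> applied to
      \<open>f\<close>. Every kernel section is an image under \<open>W\<close>, so testing
      \<open>z\<close> against \<open>\<phi> w\<close> recovers \<open>f w\<close>.\<close>
    obtain z where z: "z \<in> hcarrier L" "\<And>x. x \<in> hcarrier L \<Longrightarrow> hinner L z x = hinner F f (W x)"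
    proof (rule L.Riesz_representation[of "\<lambda>x. hinner F f (W x)" "hnorm F f"])
      show "cmod (hinner F f (W x)) \<le> hnorm F f * hnorm L x" if "x \<in> hcarrier L" for x
        using F.Cauchy_Schwarz[OF f W_mem[OF that]] by (simp add: hnorm_W that)
    qed (simp_all add: f W_mem W_add W_scale F.inner_add F.inner_scaleC)
    have "W z w = f w" for w
    proof (cases "w \<in> \<Omega>")
      case True
      have "W z w = cnj (hinner L z (\<phi> w))"
        using True L.inner_commute[OF z(1) \<phi>[OF True]] by (simp add: W_def)
      also have "\<dots> = cnj (hinner F f (?\<kappa> w))"
        using z(2)[OF \<phi>[OF True]] by (simp add: W_\<phi> True)
      also have "\<dots> = f w"
        using F.inner_commute[OF f \<kappa>[OF True]] eval[OF True f] by simp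
      finally show ?thesis .
    qed (simp add: W_def vanish f)
    then have "W z = f" by blast
    then show ?thesis using z(1) by blast
  qed
  then have "W ` hcarrier L = hcarrier F" using W_mem by blast
  moreover have "W \<in> bounded_operators L F"
    unfolding bounded_operators_def linear_between_def
    using W_mem W_add W_scale hnorm_W by (auto intro!: exI[of _ 1])
  ultimately have "W \<in> unitary_operators L F"
    by (simp add: unitary_operators_def iso)
  then show ?thesis by (simp add: W_def[abs_def])
qed

section \<open>From a factorization to its kernel\<close>

locale kernel_factorization =
  fixes X :: "'x set" and H :: "'h::complex_vector hspace"
    and K :: "'x \<Rightarrow> 'x \<Rightarrow> 'a::cstar_algebra \<Rightarrow> 'h \<Rightarrow> 'h"
    and L :: "'l::complex_vector hspace" and \<pi> :: "'a \<Rightarrow> 'l \<Rightarrow> 'l" and V :: "'x \<Rightarrow> 'h \<Rightarrow> 'l"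
  assumes hilbert: "hilbert_space H" and factorization: "factorization X H K L \<pi> V"
begin

sublocale H: hilbert_space H
  by (rule hilbert)

sublocale L: hilbert_space L
  using factorization by (simp add: factorization_def)

abbreviation "\<Omega> \<equiv> scalar_domain X H"

lemma V_bounded: "t \<in> X \<Longrightarrow> V t \<in> bounded_operators H L"
  using factorization by (simp add: factorization_def)

lemma \<pi>_bounded: "\<pi> a \<in> bounded_operators L L"
  using factorization by (simp add: factorization_def star_representation_def)

lemmas V_mem = bounded_operatorsD(1)[OF V_bounded]
  and \<pi>_mem = bounded_operatorsD(1)[OF \<pi>_bounded]

lemma \<pi>_mult: "x \<in> hcarrier L \<Longrightarrow> \<pi> (a * b) x = \<pi> a (\<pi> b x)"
  using factorization by (simp add: factorization_def star_representation_def)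

lemma \<pi>_adjoint:
  assumes "x \<in> hcarrier L" "y \<in> hcarrier L"
  shows "hinner L (\<pi> a x) y = hinner L x (\<pi> (star a) y)"
proof -
  have "\<pi> (star a) y = adjoint_op L L (\<pi> a) y"
    using factorization assms(2) by (simp add: factorization_def star_representation_def)
  then show ?thesis
    using adjoint_op(2)[OF L.hilbert_space_axioms L.cinner_space_axioms \<pi>_bounded assms(2,1)] by simp
qed

lemma V_inner:
  assumes "s \<in> X" "t \<in> X" "u \<in> hcarrier H" "v \<in> hcarrier H"
  shows "hinner L (V s u) (\<pi> a (V t v)) = hinner H u (K s t a v)"
proof -
  have "K s t a v = adjoint_op H L (V s) (\<pi> a (V t v))"
    using factorization assms by (simp add: factorization_def)
  then show ?thesis
    using adjoint_op(2)[OF hilbert L.cinner_space_axioms V_bounded[OF assms(1)]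
        \<pi>_mem[OF V_mem[OF assms(2,4)]] assms(3)] by simp
qed

definition feature :: "'x \<times> 'a \<times> 'h \<Rightarrow> 'l" where
  "feature = (\<lambda>(t, a, u). \<pi> a (V t u))"

lemma feature_mem: "w \<in> \<Omega> \<Longrightarrow> feature w \<in> hcarrier L"
  by (auto simp: feature_def scalar_domain_def \<pi>_mem V_mem)

text \<open>Moving \<open>\<pi> a\<close> to the other side as its adjoint leaves
  \<open>\<pi> (star a * b)\<close> between two maps \<open>V\<close>, and this is the kernel. Both
  the positivity of \<open>K\<close> and the unitary onto the kernel space rest on this Gram
  identity.\<close>

lemma feature_inner:
  assumes "w \<in> \<Omega>" "w' \<in> \<Omega>"
  shows "hinner L (feature w) (feature w') = scalar_kernel H K w w'"
  using assms
  by (auto simp: feature_def scalar_domain_def scalar_kernel_def \<pi>_adjoint \<pi>_mem V_mem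
      \<pi>_mult[symmetric] V_inner)

text \<open>The double sum is the squared norm of the sum of the vectors
  \<open>feature (w i)\<close>.\<close>

lemma positive_definite: "positive_definite_kernel X H K"
  unfolding positive_definite_kernel_def
proof (intro allI impI)
  fix N :: nat and u :: "nat \<Rightarrow> 'h" and s :: "nat \<Rightarrow> 'x" and a :: "nat \<Rightarrow> 'a"
  assume us: "\<forall>i\<in>{1..N}. u i \<in> hcarrier H \<and> s i \<in> X"
  define w where "w i = (s i, a i, u i)" for i
  have w: "w i \<in> \<Omega>" if "i \<in> {1..N}" for i
    using us that by (simp add: w_def scalar_domain_def)
  let ?x = "\<Sum>i=1..N. feature (w i)"
  have x: "?x \<in> hcarrier L" by (intro L.mem_sum feature_mem w)
  have "0 \<le> hinner L ?x ?x" by (rule L.inner_ge_zero[OF x])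
  also have "hinner L ?x ?x = (\<Sum>i=1..N. hinner L (feature (w i)) ?x)"
    using x by (intro L.inner_sum_left feature_mem w)
  also have "\<dots> = (\<Sum>i=1..N. \<Sum>j=1..N. scalar_kernel H K (w i) (w j))"
    by (intro sum.cong refl trans[OF L.inner_sum] feature_inner feature_mem w)
  finally show "0 \<le> (\<Sum>i=1..N. \<Sum>j=1..N. hinner H (u i) (K (s i) (s j) (star (a i) * a j) (u j)))"
    by (simp add: w_def scalar_kernel_def)
qed

definition W :: "'l \<Rightarrow> 'x \<times> 'a \<times> 'h \<Rightarrow> complex" where
  "W x w = (if w \<in> \<Omega> then hinner L (feature w) x else 0)"

lemma W_unitary:
  assumes "minimal_factorization X H K L \<pi> V" "is_rkhs \<Omega> (scalar_kernel H K) F"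
  shows "W \<in> unitary_operators L F"
proof -
  have "feature ` \<Omega> = {\<pi> a (V t u) | a t u. t \<in> X \<and> u \<in> hcarrier H}"
    by (auto simp: feature_def scalar_domain_def image_def)
  then have "hcarrier L = closed_span L (feature ` \<Omega>)"
    using assms(1) by (simp add: minimal_factorization_def)
  from unitary_onto_rkhs[OF L.hilbert_space_axioms assms(2) feature_mem feature_inner this]
  show ?thesis by (simp add: W_def[abs_def])
qed

lemma W_V:
  assumes "t \<in> X" "v \<in> hcarrier H"
  shows "W (V t v) (s, a, u) = (if (s, a, u) \<in> \<Omega> then hinner H u (K s t (star a) v) else 0)"
  using assms by (auto simp: W_def feature_def scalar_domain_def \<pi>_adjoint V_mem V_inner)

text \<open>Seen through \<open>W\<close>, every representation becomes the same change of argument,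
  by taking the adjoint of \<open>\<pi> a\<close>. Outside the domain both sides are 0, since
  membership does not involve the algebra coordinate.\<close>

lemma W_\<pi>:
  assumes "x \<in> hcarrier L"
  shows "W (\<pi> a x) (s, c, u) = W x (s, star a * c, u)"
proof (cases "s \<in> X \<and> u \<in> hcarrier H")
  case True
  then show ?thesis
    using assms \<pi>_adjoint[of "\<pi> c (V s u)" x "star a"]
    by (simp add: W_def feature_def scalar_domain_def \<pi>_mem V_mem \<pi>_mult star_star)
qed (auto simp: W_def scalar_domain_def)

end

lemma kernel_factorization_minimal:
  "hilbert_space H \<Longrightarrow> minimal_factorization X H K L \<pi> V \<Longrightarrow> kernel_factorization X H K L \<pi> V"
  by (simp add: kernel_factorization_def minimal_factorization_def)

text \<open>The map is the inverse of \<open>U'\<close> after \<open>U\<close>, described by an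
  equation in \<open>F\<close>. Injectivity of \<open>U'\<close> is part of the conclusion so that
  equations in \<open>L'\<close> can be verified after applying \<open>U'\<close>.\<close>

lemma unitary_operators_factor:
  assumes L: "cinner_space L" and L': "cinner_space L'"
    and U: "U \<in> unitary_operators L F" and U': "U' \<in> unitary_operators L' F"
  obtains W where "W \<in> unitary_operators L L'" "\<And>x. x \<in> hcarrier L \<Longrightarrow> U' (W x) = U x"
    "inj_on U' (hcarrier L')"
proof -
  interpret L: cinner_space L by fact
  interpret L': cinner_space L' by fact
  have UD: "U x \<in> hcarrier F" "hinner F (U x) (U y) = hinner L x y"
    "U (x + y) = U x + U y" "U (c *\<^sub>C x) = c *\<^sub>C U x"
    if "x \<in> hcarrier L" "y \<in> hcarrier L" for x y c
    using U that bounded_operatorsD[of U L F] by (auto simp: unitary_operators_def)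
  have UD': "U' x \<in> hcarrier F" "hinner F (U' x) (U' y) = hinner L' x y"
    "U' (x + y) = U' x + U' y" "U' (c *\<^sub>C x) = c *\<^sub>C U' x"
    if "x \<in> hcarrier L'" "y \<in> hcarrier L'" for x y c
    using U' that bounded_operatorsD[of U' L' F] by (auto simp: unitary_operators_def)
  have image: "U ` hcarrier L = hcarrier F" "U' ` hcarrier L' = hcarrier F"
    using U U' by (auto simp: unitary_operators_def)
  have inj: "inj_on U' (hcarrier L')"
  proof (rule inj_onI)
    fix x y assume xy: "x \<in> hcarrier L'" "y \<in> hcarrier L'" "U' x = U' y"
    show "x = y"
      by (rule L'.inner_eqI[OF xy(1,2)]) (metis UD'(2) xy)
  qed
  define W where "W x = inv_into (hcarrier L') U' (U x)" for x
  have W_mem: "W x \<in> hcarrier L'" and U'_W: "U' (W x) = U x" if "x \<in> hcarrier L" for x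
    using UD(1)[OF that that] image(2) by (auto simp: W_def inv_into_into f_inv_into_f)
  have eqI: "x = y" if "x \<in> hcarrier L'" "y \<in> hcarrier L'" "U' x = U' y" for x y
    using inj_onD[OF inj] that by blast
  have W_inner: "hinner L' (W x) (W y) = hinner L x y" if "x \<in> hcarrier L" "y \<in> hcarrier L" for x y
    using UD'(2)[OF W_mem W_mem, OF that] UD(2)[OF that] U'_W that by simp
  have W_add: "W (x + y) = W x + W y" if "x \<in> hcarrier L" "y \<in> hcarrier L" for x y
    using that by (intro eqI) (simp_all add: W_mem L.mem_add L'.mem_add U'_W UD UD')
  have W_scale: "W (c *\<^sub>C x) = c *\<^sub>C W x" if "x \<in> hcarrier L" for c x
    using that UD'(4)[OF W_mem W_mem] UD(4)
    by (intro eqI) (simp_all add: W_mem L.mem_scaleC L'.mem_scaleC U'_W)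
  have "\<exists>x\<in>hcarrier L. W x = y" if y: "y \<in> hcarrier L'" for y
  proof -
    obtain x where x: "x \<in> hcarrier L" "U x = U' y" using image UD'(1)[OF y y] by (metis imageE)
    then show ?thesis using eqI[OF W_mem y] U'_W by auto
  qed
  then have "W ` hcarrier L = hcarrier L'" using W_mem by blast
  moreover have "W \<in> bounded_operators L L'"
    unfolding bounded_operators_def linear_between_def
    using W_mem W_add W_scale W_inner by (auto intro!: exI[of _ 1] simp: hnorm_def)
  ultimately have "W \<in> unitary_operators L L'"
    by (simp add: unitary_operators_def W_inner)
  then show thesis using that U'_W inj by blast
qed

lemma minimal_factorization_unique:
  assumes H: "hilbert_space H" and F: "is_rkhs (scalar_domain X H) (scalar_kernel H K) F"
    and L: "minimal_factorization X H K L \<pi> V" and L': "minimal_factorization X H K L' \<pi>' V'"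
  obtains W where "W \<in> unitary_operators L L'"
    "\<And>t u. t \<in> X \<Longrightarrow> u \<in> hcarrier H \<Longrightarrow> W (V t u) = V' t u"
    "\<And>a x. x \<in> hcarrier L \<Longrightarrow> W (\<pi> a x) = \<pi>' a (W x)"
proof -
  interpret L: kernel_factorization X H K L \<pi> V by (rule kernel_factorization_minimal[OF H L])
  interpret L': kernel_factorization X H K L' \<pi>' V' by (rule kernel_factorization_minimal[OF H L'])
  obtain W where W: "W \<in> unitary_operators L L'" and eq: "\<And>x. x \<in> hcarrier L \<Longrightarrow> L'.W (W x) = L.W x"
    and inj: "inj_on L'.W (hcarrier L')"
    using unitary_operators_factor[OF L.L.cinner_space_axioms L'.L.cinner_space_axioms
        L.W_unitary[OF L F] L'.W_unitary[OF L' F]] by blast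
  have W_mem: "W x \<in> hcarrier L'" if "x \<in> hcarrier L" for x
    using W that by (auto simp: unitary_operators_def)
  show thesis
  proof (rule that[OF W])
    fix t u assume tu: "t \<in> X" "u \<in> hcarrier H"
    have "L'.W (W (V t u)) = L'.W (V' t u)"
      using tu by (simp add: eq L.V_mem fun_eq_iff L.W_V L'.W_V)
    then show "W (V t u) = V' t u"
      using tu by (intro inj_onD[OF inj] W_mem L.V_mem L'.V_mem)
  next
    fix a x assume x: "x \<in> hcarrier L"
    have "L'.W (W (\<pi> a x)) = L'.W (\<pi>' a (W x))"
      using x by (simp add: eq L.\<pi>_mem fun_eq_iff L.W_\<pi> L'.W_\<pi> W_mem)
    then show "W (\<pi> a x) = \<pi>' a (W x)"
      using x by (intro inj_onD[OF inj] W_mem L.\<pi>_mem L'.\<pi>_mem)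
  qed
qed

section \<open>The factorization through the reproducing kernel Hilbert space\<close>

lemma star_one: "star (1 :: 'a::cstar_algebra) = 1"
  using star_mult[of "star 1" "1 :: 'a"] by (simp add: star_star)

lemma star_power: "star (a ^ n) = star a ^ n" for a :: "'a::cstar_algebra"
  by (induction n) (simp_all add: star_one star_mult power_commutes)

text \<open>Starting at exponent 1 keeps the norm of the unit out of the argument; the exponents
  \<open>2 ^ n\<close> used later are all positive.\<close>

lemma norm_power_le: "n > 0 \<Longrightarrow> norm (a ^ n) \<le> norm a ^ n" for a :: "'a::cstar_algebra"
proof (induction n rule: nat_induct_non_zero)
  case (Suc n)
  then show ?case
    using norm_mult_ineq[of a "a ^ n"] mult_left_mono[of "norm (a ^ n)" "norm a ^ n" "norm a"] by simp
qed simp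

text \<open>Iterating \<open>step\<close> bounds \<open>y 0 ^ (2 ^ n)\<close> by a fixed constant
  times \<open>(A * r) ^ (2 ^ n)\<close>, and the constant is lost on taking roots of order 2^n. The
  conclusion is therefore independent of \<open>C\<close>.\<close>

lemma geometric_squaring_bound:
  fixes y :: "nat \<Rightarrow> real"
  assumes y: "\<And>n. 0 \<le> y n" and step: "\<And>n. (y n)\<^sup>2 \<le> A * y (Suc n)"
    and growth: "\<And>n. y n \<le> C * r ^ (2 ^ n)" and A: "0 \<le> A" and r: "0 \<le> r"
  shows "y 0 \<le> A * r"
proof (cases "A = 0 \<or> r = 0")
  case True
  then show ?thesis using step[of 0] growth[of 0] by auto
next
  case False
  then have A: "A > 0" and r: "r > 0" using A r by auto
  \<comment> \<open>The additional factor \<open>A\<close> on the left avoids the exponent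
    \<open>2 ^ n - 1\<close>.\<close>
  have iterate: "A * y 0 ^ (2 ^ n) \<le> A ^ (2 ^ n) * y n" for n
  proof (induction n)
    case (Suc n)
    have "A * (A * y 0 ^ (2 ^ Suc n)) = (A * y 0 ^ (2 ^ n))\<^sup>2"
      by (simp add: power_mult_distrib power2_eq_square mult_2 power_add)
    also have "\<dots> \<le> (A ^ (2 ^ n) * y n)\<^sup>2"
      using Suc A y[of 0] by (intro power_mono) simp_all
    also have "\<dots> = A ^ (2 ^ Suc n) * (y n)\<^sup>2"
      by (simp add: power_mult_distrib power2_eq_square mult_2 power_add)
    also have "\<dots> \<le> A ^ (2 ^ Suc n) * (A * y (Suc n))"
      using A by (intro mult_left_mono step) simp
    also have "\<dots> = A * (A ^ (2 ^ Suc n) * y (Suc n))" by simp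
    finally show ?case using A by (simp only: mult_le_cancel_left_pos)
  qed simp
  show ?thesis
  proof (rule ccontr)
    assume "\<not> y 0 \<le> A * r"
    then have q: "y 0 / (A * r) > 1" using A r by (simp add: divide_simps)
    \<comment> \<open>In place of roots: powers of a number above 1 are unbounded, whereas those
      with exponent \<open>2 ^ m\<close> are at most \<open>C / A\<close>. The two meet because
      \<open>m\<close> is at most \<open>2 ^ m\<close>.\<close>
    obtain m where m: "C / A < (y 0 / (A * r)) ^ m"
      using real_arch_pow[OF q] by blast
    have "(y 0 / (A * r)) ^ m \<le> (y 0 / (A * r)) ^ (2 ^ m)"
      using q by (intro power_increasing) (auto intro: less_imp_le)
    also have "\<dots> \<le> C / A"
    proof -
      have "A * y 0 ^ (2 ^ m) \<le> A ^ (2 ^ m) * (C * r ^ (2 ^ m))"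
        using iterate[of m] mult_left_mono[OF growth[of m], of "A ^ (2 ^ m)"] A
        by (meson less_imp_le order_trans zero_le_power)
      then show ?thesis using A r by (simp add: power_divide power_mult_distrib field_simps)
    qed
    finally show False using m by simp
  qed
qed

lemma operator_norm_bound:
  assumes H: "cinner_space H" and T: "T \<in> bounded_operators H L" and u: "u \<in> hcarrier H"
    and L: "cinner_space L"
  shows "hnorm L (T u) \<le> operator_norm H L T * hnorm H u"
proof -
  interpret H: cinner_space H by fact
  interpret L: cinner_space L by fact
  note D = bounded_operatorsD[OF T]
  obtain M where M: "M \<ge> 0" "\<And>x. x \<in> hcarrier H \<Longrightarrow> hnorm L (T x) \<le> M * hnorm H x"
    using bounded_operators_bound[OF H T] by blast
  show ?thesis
  proof (cases "hnorm H u = 0")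
    case True
    then show ?thesis using M(2)[OF u] by simp
  next
    case False
    then have pos: "hnorm H u > 0" using H.hnorm_nonneg[OF u] by simp
    define c where "c = complex_of_real (1 / hnorm H u)"
    have c: "cmod c = 1 / hnorm H u" using pos by (simp add: c_def norm_divide)
    have cu: "c *\<^sub>C u \<in> {x \<in> hcarrier H. hnorm H x \<le> 1}"
      using pos by (simp add: H.mem_scaleC u H.hnorm_scaleC c)
    \<comment> \<open>The supremum in \<open>operator_norm\<close> is informative only for a set
      that is bounded above, which is where boundedness of \<open>T\<close> enters.\<close>
    have "bdd_above ((\<lambda>x. hnorm L (T x)) ` {x \<in> hcarrier H. hnorm H x \<le> 1})"
    proof (rule bdd_aboveI2)
      fix x assume "x \<in> {x \<in> hcarrier H. hnorm H x \<le> 1}"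
      then show "hnorm L (T x) \<le> M"
        using M(2)[of x] mult_left_mono[of "hnorm H x" 1 M] M(1) by simp
    qed
    then have "hnorm L (T (c *\<^sub>C u)) \<le> operator_norm H L T"
      unfolding operator_norm_def using cu by (intro cSUP_upper)
    then show ?thesis
      using pos by (simp add: D u L.hnorm_scaleC c divide_simps mult.commute)
  qed
qed

section \<open>Operator-valued kernels and their scalar kernels\<close>

locale pd_operator_kernel =
  fixes X :: "'x set" and H :: "'h::complex_vector hspace"
    and K :: "'x \<Rightarrow> 'x \<Rightarrow> 'a::cstar_algebra \<Rightarrow> 'h \<Rightarrow> 'h"
  assumes hilbert: "hilbert_space H"
    and K_maps: "\<And>s t. s \<in> X \<Longrightarrow> t \<in> X \<Longrightarrow> K s t \<in> bounded_maps_into_operators H"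
    and pd: "positive_definite_kernel X H K"
begin

sublocale H: hilbert_space H
  by (rule hilbert)

lemma K_bounded: "s \<in> X \<Longrightarrow> t \<in> X \<Longrightarrow> K s t a \<in> bounded_operators H H"
  using K_maps by (auto simp: bounded_maps_into_operators_def)

lemmas K_mem = bounded_operatorsD(1)[OF K_bounded]
  and K_add = bounded_operatorsD(2)[OF K_bounded]
  and K_scaleC = bounded_operatorsD(3)[OF K_bounded]

lemma K_add_algebra:
  "s \<in> X \<Longrightarrow> t \<in> X \<Longrightarrow> u \<in> hcarrier H \<Longrightarrow> K s t (a + b) u = K s t a u + K s t b u"
  using K_maps by (auto simp: bounded_maps_into_operators_def)

lemma K_scaleC_algebra:
  "s \<in> X \<Longrightarrow> t \<in> X \<Longrightarrow> u \<in> hcarrier H \<Longrightarrow> K s t (c *\<^sub>C a) u = c *\<^sub>C K s t a u"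
  using K_maps by (auto simp: bounded_maps_into_operators_def)

lemma K_norm_bound:
  assumes "s \<in> X" "t \<in> X"
  obtains M where "M \<ge> 0"
    "\<And>a u. u \<in> hcarrier H \<Longrightarrow> hnorm H (K s t a u) \<le> M * norm a * hnorm H u"
proof -
  obtain M where M: "\<And>a. operator_norm H H (K s t a) \<le> M * norm a"
    using K_maps[OF assms] by (auto simp: bounded_maps_into_operators_def)
  have "hnorm H (K s t a u) \<le> \<bar>M\<bar> * norm a * hnorm H u" if u: "u \<in> hcarrier H" for a u
  proof -
    have "hnorm H (K s t a u) \<le> operator_norm H H (K s t a) * hnorm H u"
      by (rule operator_norm_bound[OF H.cinner_space_axioms K_bounded[OF assms] u H.cinner_space_axioms])
    also have "\<dots> \<le> (\<bar>M\<bar> * norm a) * hnorm H u"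
      using M[of a] mult_right_mono[OF abs_ge_self[of M] norm_ge_zero[of a]]
      by (intro mult_right_mono H.hnorm_nonneg u) linarith
    finally show ?thesis .
  qed
  then show thesis using that[of "\<bar>M\<bar>"] by simp
qed

abbreviation "\<Omega> \<equiv> scalar_domain X H"
abbreviation "k \<equiv> scalar_kernel H K"

lemma scalar_domain_iff: "(s, a, u) \<in> \<Omega> \<longleftrightarrow> s \<in> X \<and> u \<in> hcarrier H"
  by (simp add: scalar_domain_def)

lemma scalar_kernel_apply: "k (s, a, u) (t, b, v) = hinner H u (K s t (star a * b) v)"
  by (simp add: scalar_kernel_def)

text \<open>Scalar coefficients are absorbed into the vectors, with
  \<open>c (e i) *\<^sub>C u i\<close> taking the place of \<open>u i\<close>. The enumeration
  \<open>e\<close> passes from finite sets of points to the indexed families in the hypothesis on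
  \<open>K\<close>.\<close>

lemma pd_kernel_scalar: "pd_kernel \<Omega> k"
proof
  fix S :: "('x \<times> 'a \<times> 'h) set" and c
  assume S: "finite S" "S \<subseteq> \<Omega>"
  obtain e where e: "bij_betw e {1..card S} S"
    using ex_bij_betw_nat_finite_1[OF S(1)] by blast
  define s a u where "s i = fst (e i)" and "a i = fst (snd (e i))" and "u i = snd (snd (e i))" for i
  have e_eq: "e i = (s i, a i, u i)" for i by (simp add: s_def a_def u_def)
  have e_mem: "s i \<in> X \<and> u i \<in> hcarrier H" if "i \<in> {1..card S}" for i
    using bij_betwE[OF e] that S(2) e_eq[of i] by (fastforce simp: scalar_domain_def)
  have reindex: "(\<Sum>j=1..card S. cnj (c x) * c (e j) * k x (e j)) = (\<Sum>y\<in>S. cnj (c x) * c y * k x y)" for x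
    by (rule sum.reindex_bij_betw[OF e])
  let ?u = "\<lambda>i. c (e i) *\<^sub>C u i"
  have "0 \<le> (\<Sum>i=1..card S. \<Sum>j=1..card S. hinner H (?u i) (K (s i) (s j) (star (a i) * a j) (?u j)))"
    using pd[unfolded positive_definite_kernel_def, rule_format, of "card S" ?u s a]
    by (simp add: e_mem H.mem_scaleC)
  also have "\<dots> = (\<Sum>i=1..card S. \<Sum>j=1..card S. cnj (c (e i)) * c (e j) * k (e i) (e j))"
    by (intro sum.cong refl)
      (simp add: e_eq e_mem scalar_kernel_apply K_scaleC K_mem H.inner_scaleC H.inner_scaleC_left H.mem_scaleC)
  also have "\<dots> = (\<Sum>x\<in>S. \<Sum>y\<in>S. cnj (c x) * c y * k x y)"
    unfolding reindex by (rule sum.reindex_bij_betw[OF e])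
  finally show "0 \<le> (\<Sum>x\<in>S. \<Sum>y\<in>S. cnj (c x) * c y * k x y)" .
qed

sublocale pd_kernel \<Omega> k
  by (rule pd_kernel_scalar)

text \<open>The formula is forced by \<open>\<langle>\<kappa> w, \<pi>(a) f\<rangle> = \<langle>\<pi>(a\<^sup>*) (\<kappa> w), f\<rangle>\<close> and lemma \<open>shift_kernel_section\<close> below.\<close>

definition shift :: "'a \<Rightarrow> ('x \<times> 'a \<times> 'h \<Rightarrow> complex) \<Rightarrow> 'x \<times> 'a \<times> 'h \<Rightarrow> complex" where
  "shift a f = (\<lambda>(s, c, u). f (s, star a * c, u))"

section \<open>Shift operators on the span of the kernel sections\<close>

lemma shift_apply: "shift a f (s, c, u) = f (s, star a * c, u)"
  by (simp add: shift_def)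

lemma shift_zero: "shift a 0 = 0"
  by (auto simp: shift_def fun_eq_iff)

lemma shift_add: "shift a (f + g) = shift a f + shift a g"
  by (auto simp: shift_def fun_eq_iff)

lemma shift_diff: "shift a (f - g) = shift a f - shift a g"
  by (auto simp: shift_def fun_eq_iff)

lemma shift_scaleC: "shift a (c *\<^sub>C f) = c *\<^sub>C shift a f"
  by (auto simp: shift_def fun_eq_iff)

lemma shift_mult: "shift (a * b) f = shift a (shift b f)"
  by (auto simp: shift_def fun_eq_iff star_mult mult.assoc)

text \<open>Since \<open>star (star a * c) * b = star c * (a * b)\<close>, the element
  \<open>a\<close> moves from one argument of the kernel to the other. Hence sections go to
  sections, and the span is invariant.\<close>

lemma shift_kernel_section: "shift a (\<kappa> (t, b, v)) = \<kappa> (t, a * b, v)"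
  by (auto simp: shift_def fun_eq_iff kernel_section_def scalar_domain_iff scalar_kernel_apply
      star_mult star_star mult.assoc)

lemma shift_pre_space:
  assumes "f \<in> hcarrier pre_space"
  shows "shift a f \<in> hcarrier pre_space"
  using assms unfolding carrier_pre_space
proof (induction rule: complex_vector.span_induct_alt)
  case base
  show ?case unfolding shift_zero by (rule complex_vector.span_zero)
next
  case (step c f g)
  then obtain t b v where w: "(t, b, v) \<in> \<Omega>" "f = \<kappa> (t, b, v)" by auto
  then have "(t, a * b, v) \<in> \<Omega>" by (simp add: scalar_domain_iff)
  then show ?case
    unfolding w(2) shift_add shift_scaleC shift_kernel_section
    using step by (intro complex_vector.span_add complex_vector.span_scale kernel_section_mem)
qed

lemma pre_space_rkhs_induct [consumes 1, case_names zero step]: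
  assumes "f \<in> hcarrier pre_space" "P 0"
    and "\<And>c t b v g. (t, b, v) \<in> \<Omega> \<Longrightarrow> g \<in> hcarrier pre_space \<Longrightarrow> P g \<Longrightarrow> P (c *\<^sub>C \<kappa> (t, b, v) + g)"
  shows "P f"
proof -
  have "f \<in> hcarrier pre_space \<and> P f"
    using assms(1) unfolding carrier_pre_space
  proof (induction rule: complex_vector.span_induct_alt)
    case base
    show ?case using assms(2) complex_vector.span_zero by blast
  next
    case (step c x y)
    then obtain t b v where w: "(t, b, v) \<in> \<Omega>" "x = \<kappa> (t, b, v)" by auto
    then show ?case
      using step assms(3)[OF w(1), of y c] unfolding carrier_pre_space
      by (blast intro: complex_vector.span_add complex_vector.span_scale complex_vector.span_base)
  qed
  then show ?thesis ..
qed

lemma kernel_section_rkhs: "w \<in> \<Omega> \<Longrightarrow> \<kappa> w \<in> hcarrier rkhs"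
  by (intro pre_space_subset_rkhs kernel_section_pre_space)

text \<open>On a kernel section both sides evaluate \<open>g\<close> at the same point. Membership
  of \<open>shift a g\<close> is a hypothesis because invariance of the whole space follows only
  from the norm bound, whose proof uses this identity.\<close>

lemma shift_adjoint_pre_space:
  assumes f: "f \<in> hcarrier pre_space" and g: "g \<in> hcarrier rkhs" "shift a g \<in> hcarrier rkhs"
  shows "hinner rkhs f (shift a g) = hinner rkhs (shift (star a) f) g"
  using f
proof (induction rule: pre_space_rkhs_induct)
  case zero
  show ?case unfolding shift_zero F.inner_zero_left[OF g(1)] F.inner_zero_left[OF g(2)] ..
next
  case (step c t b v h)
  have w: "(t, star a * b, v) \<in> \<Omega>" using step(1) by (simp add: scalar_domain_iff)
  have h: "h \<in> hcarrier rkhs" "shift (star a) h \<in> hcarrier rkhs"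
    using step(2) by (auto intro: pre_space_subset_rkhs shift_pre_space)
  note mem = kernel_section_rkhs[OF step(1)] kernel_section_rkhs[OF w]
  have "hinner rkhs (c *\<^sub>C \<kappa> (t, b, v) + h) (shift a g)
      = cnj c * shift a g (t, b, v) + hinner rkhs h (shift a g)"
    by (simp only: F.inner_add_left F.inner_scaleC_left F.mem_scaleC mem h g rkhs_eval[OF step(1)])
  moreover have "hinner rkhs (c *\<^sub>C \<kappa> (t, star a * b, v) + shift (star a) h) g
      = cnj c * g (t, star a * b, v) + hinner rkhs (shift (star a) h) g"
    by (simp only: F.inner_add_left F.inner_scaleC_left F.mem_scaleC mem h g rkhs_eval[OF w])
  ultimately show ?case
    by (simp only: shift_add shift_scaleC shift_kernel_section step(3) shift_apply)
qed

section \<open>Boundedness of the shift operators\<close>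

lemma hnorm_kernel_section_bound:
  assumes "t \<in> X"
  obtains M where "M \<ge> 0"
    "\<And>b v. v \<in> hcarrier H \<Longrightarrow> hnorm rkhs (\<kappa> (t, b, v)) \<le> M * norm b * hnorm H v"
proof -
  obtain M where M: "M \<ge> 0"
      "\<And>a u. u \<in> hcarrier H \<Longrightarrow> hnorm H (K t t a u) \<le> M * norm a * hnorm H u"
    using K_norm_bound[OF assms assms] by blast
  have "hnorm rkhs (\<kappa> (t, b, v)) \<le> sqrt M * norm b * hnorm H v" if v: "v \<in> hcarrier H" for b v
  proof (rule power2_le_imp_le)
    have w: "(t, b, v) \<in> \<Omega>" using assms v by (simp add: scalar_domain_iff)
    have "hinner rkhs (\<kappa> (t, b, v)) (\<kappa> (t, b, v)) = hinner H v (K t t (star b * b) v)"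
      using rkhs_eval[OF w kernel_section_rkhs[OF w]] w
      by (simp add: kernel_section_apply scalar_kernel_apply)
    then have "(hnorm rkhs (\<kappa> (t, b, v)))\<^sup>2 = cmod (hinner H v (K t t (star b * b) v))"
      using F.inner_self_real[OF kernel_section_rkhs[OF w]]
      by (metis abs_of_nonneg norm_of_real zero_le_power2)
    \<comment> \<open>Boundedness of \<open>K t t\<close> in its algebra argument enters here; the
      C*-identity then makes the bound a perfect square, which explains
      \<open>sqrt M\<close>.\<close>
    also have "\<dots> \<le> hnorm H v * (M * norm (star b * b) * hnorm H v)"
      by (intro order_trans[OF H.Cauchy_Schwarz] mult_left_mono M v K_mem assms H.hnorm_nonneg)
    also have "\<dots> = (sqrt M * norm b * hnorm H v)\<^sup>2"
      using M(1) by (simp add: norm_star_mult power_mult_distrib power2_eq_square)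
    finally show "(hnorm rkhs (\<kappa> (t, b, v)))\<^sup>2 \<le> (sqrt M * norm b * hnorm H v)\<^sup>2" .
    show "0 \<le> sqrt M * norm b * hnorm H v" using M(1) H.hnorm_nonneg[OF v] by simp
  qed
  then show thesis using that[of "sqrt M"] M(1) by simp
qed

text \<open>The constant stems from an expansion of \<open>f\<close> into sections and is not
  controlled by the norm of \<open>f\<close>, so this is not yet boundedness. It serves as the
  growth hypothesis of \<open>geometric_squaring_bound\<close>, whose conclusion does not contain
  it.\<close>

lemma shift_growth:
  assumes "f \<in> hcarrier pre_space"
  obtains C where "C \<ge> 0" "\<And>a. hnorm rkhs (shift a f) \<le> C * norm a"
proof -
  have "\<exists>C\<ge>0. \<forall>a. hnorm rkhs (shift a f) \<le> C * norm a"
    using assms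
  proof (induction rule: pre_space_rkhs_induct)
    case zero
    show ?case unfolding shift_zero F.hnorm_zero by (intro exI[of _ 0]) simp
  next
    case (step c t b v g)
    obtain C where C: "C \<ge> 0" "\<And>a. hnorm rkhs (shift a g) \<le> C * norm a" using step(3) by blast
    have tv: "t \<in> X" "v \<in> hcarrier H" using step(1) by (simp_all add: scalar_domain_iff)
    obtain M where M: "M \<ge> 0" "\<And>b. hnorm rkhs (\<kappa> (t, b, v)) \<le> M * norm b * hnorm H v"
      using hnorm_kernel_section_bound[OF tv(1)] tv(2) by metis
    define D where "D = cmod c * (M * norm b * hnorm H v) + C"
    have "hnorm rkhs (shift a (c *\<^sub>C \<kappa> (t, b, v) + g)) \<le> D * norm a" for a
    proof -
      have w: "(t, a * b, v) \<in> \<Omega>" using tv by (simp add: scalar_domain_iff)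
      have "hnorm rkhs (shift a (c *\<^sub>C \<kappa> (t, b, v) + g))
          \<le> hnorm rkhs (c *\<^sub>C \<kappa> (t, a * b, v)) + hnorm rkhs (shift a g)"
        unfolding shift_add shift_scaleC shift_kernel_section
        using w step(2) by (intro F.hnorm_triangle F.mem_scaleC kernel_section_rkhs
            pre_space_subset_rkhs[OF shift_pre_space])
      also have "hnorm rkhs (c *\<^sub>C \<kappa> (t, a * b, v)) = cmod c * hnorm rkhs (\<kappa> (t, a * b, v))"
        by (rule F.hnorm_scaleC[OF kernel_section_rkhs[OF w]])
      also have "\<dots> \<le> cmod c * (M * (norm a * norm b) * hnorm H v)"
        by (intro mult_left_mono order_trans[OF M(2)] mult_right_mono M(1) norm_mult_ineq
            H.hnorm_nonneg tv) simp_all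
      finally show ?thesis using C(2)[of a]
        by (simp add: D_def algebra_simps del: plus_fun_apply scaleC_fun_apply)
    qed
    moreover have "D \<ge> 0" using M(1) C(1) H.hnorm_nonneg[OF tv(2)] by (simp add: D_def)
    ultimately show ?case by blast
  qed
  then show thesis using that by blast
qed

text \<open>With \<open>h = a\<^sup>* a\<close>, the Cauchy-Schwarz inequality gives
  \<open>\<parallel>\<pi>(h\<^sup>n) f\<parallel>\<^sup>2 \<le> \<parallel>f\<parallel> \<parallel>\<pi>(h\<^sup>2\<^sup>n) f\<parallel>\<close>; iterating it turns the crude growth bound
  into \<open>\<parallel>\<pi>(h) f\<parallel> \<le> \<parallel>f\<parallel> \<parallel>h\<parallel>\<close> without square roots in the algebra.\<close>

lemma shift_bound_pre_space:
  assumes f: "f \<in> hcarrier pre_space"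
  shows "hnorm rkhs (shift a f) \<le> norm a * hnorm rkhs f"
proof -
  have mem: "shift b f \<in> hcarrier rkhs" "f \<in> hcarrier rkhs" "shift b f \<in> hcarrier pre_space" for b
    using f by (auto intro: pre_space_subset_rkhs shift_pre_space)
  have square: "(hnorm rkhs (shift b f))\<^sup>2 \<le> hnorm rkhs f * hnorm rkhs (shift (star b * b) f)" for b
  proof -
    have "hinner rkhs (shift b f) (shift b f) = hinner rkhs (shift (star b) (shift b f)) f"
      by (rule shift_adjoint_pre_space) (simp_all add: mem)
    then have "(hnorm rkhs (shift b f))\<^sup>2 = cmod (hinner rkhs (shift (star b * b) f) f)"
      using F.inner_self_real[OF mem(1)] by (metis abs_of_nonneg norm_of_real zero_le_power2 shift_mult)
    also have "\<dots> \<le> hnorm rkhs (shift (star b * b) f) * hnorm rkhs f"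
      by (intro F.Cauchy_Schwarz mem)
    finally show ?thesis by (simp add: mult.commute)
  qed
  define h where "h = star a * a"
  have h: "star h = h" by (simp add: h_def star_mult star_star)
  \<comment> \<open>As \<open>h\<close> is self-adjoint,
    \<open>star (h ^ (2 ^ n)) * h ^ (2 ^ n)\<close> is \<open>h ^ (2 ^ Suc n)\<close>, so
    \<open>square\<close> relates consecutive terms.\<close>
  define y where "y n = hnorm rkhs (shift (h ^ (2 ^ n)) f)" for n :: nat
  obtain C where C: "C \<ge> 0" "\<And>a. hnorm rkhs (shift a f) \<le> C * norm a"
    using shift_growth[OF f] by blast
  have "y 0 \<le> hnorm rkhs f * norm h"
  proof (rule geometric_squaring_bound[where C = C])
    fix n
    show "0 \<le> y n" by (simp add: y_def F.hnorm_nonneg mem)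
    show "(y n)\<^sup>2 \<le> hnorm rkhs f * y (Suc n)"
      using square[of "h ^ (2 ^ n)"] by (simp add: y_def star_power h mult_2 power_add)
    show "y n \<le> C * norm h ^ (2 ^ n)"
      unfolding y_def using C norm_power_le[of "2 ^ n" h]
      by (intro order_trans[OF C(2)] mult_left_mono) simp_all
  qed (simp_all add: F.hnorm_nonneg mem)
  \<comment> \<open>One further use of \<open>square\<close>, at \<open>a\<close> itself, passes
    from \<open>h\<close> back to \<open>a\<close>; the C*-identity then replaces
    \<open>norm h\<close> by the square of \<open>norm a\<close>.\<close>
  then have "(hnorm rkhs (shift a f))\<^sup>2 \<le> hnorm rkhs f * (hnorm rkhs f * norm h)"
    using square[of a] mult_left_mono[of "y 0" _ "hnorm rkhs f"] F.hnorm_nonneg[OF mem(2)]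
    by (fastforce simp: y_def h_def intro: order_trans)
  also have "\<dots> = (norm a * hnorm rkhs f)\<^sup>2"
    by (simp add: h_def norm_star_mult power_mult_distrib power2_eq_square)
  finally show ?thesis
    by (rule power2_le_imp_le) (simp add: F.hnorm_nonneg mem)
qed

text \<open>The bound on the span yields some norm limit of the images. It must be
  \<open>shift a f\<close>, because a value of a shifted function is a value of the original one at
  another point, and norm convergence implies pointwise convergence. So the formula agrees with the
  continuous extension.\<close>

lemma shift_hconverges:
  assumes \<sigma>: "range \<sigma> \<subseteq> hcarrier pre_space" and lim: "hconverges rkhs \<sigma> f"
  shows "hconverges rkhs (\<lambda>n. shift a (\<sigma> n)) (shift a f)"
proof -
  have mem: "\<sigma> n \<in> hcarrier pre_space" for n using \<sigma> by blast
  have le: "hnorm rkhs (shift a (\<sigma> m) - shift a (\<sigma> n)) \<le> norm a * hnorm rkhs (\<sigma> m - \<sigma> n)" for m n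
    unfolding shift_diff[symmetric] by (intro shift_bound_pre_space P.mem_diff mem)
  have "hCauchy rkhs (\<lambda>n. shift a (\<sigma> n))"
    unfolding hCauchy_def
  proof (intro conjI allI impI)
    show "range (\<lambda>n. shift a (\<sigma> n)) \<subseteq> hcarrier rkhs"
      using mem by (auto intro: pre_space_subset_rkhs shift_pre_space)
    fix e :: real assume e: "e > 0"
    have pos: "norm a + 1 > 0" by (simp add: add_nonneg_pos)
    obtain N where N: "\<And>m n. m \<ge> N \<Longrightarrow> n \<ge> N \<Longrightarrow> hnorm rkhs (\<sigma> m - \<sigma> n) < e / (norm a + 1)"
      using hCauchyD[OF F.hconverges_imp_hCauchy[OF lim], of "e / (norm a + 1)"] e pos by fastforce
    have "hnorm rkhs (shift a (\<sigma> m) - shift a (\<sigma> n)) < e" if "m \<ge> N" "n \<ge> N" for m n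
    proof -
      have "norm a * hnorm rkhs (\<sigma> m - \<sigma> n) \<le> (norm a + 1) * hnorm rkhs (\<sigma> m - \<sigma> n)"
        by (intro mult_right_mono F.hnorm_nonneg F.mem_diff pre_space_subset_rkhs mem) simp
      also have "\<dots> < e" using N[OF that] pos by (simp add: field_simps)
      finally show ?thesis using le[of m n] by simp
    qed
    then show "\<exists>N. \<forall>m\<ge>N. \<forall>n\<ge>N. hnorm rkhs (shift a (\<sigma> m) - shift a (\<sigma> n)) < e" by blast
  qed
  then obtain g where g: "hconverges rkhs (\<lambda>n. shift a (\<sigma> n)) g"
    using hilbert_space.hCauchy_imp_hconverges[OF hilbert_space_rkhs] by blast
  have "g (s, c, u) = shift a f (s, c, u)" for s c u
    using rkhs_hconverges_pointwise[OF is_rkhs_rkhs g, of "(s, c, u)"]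
      rkhs_hconverges_pointwise[OF is_rkhs_rkhs lim, of "(s, star a * c, u)"]
    by (simp add: shift_apply LIMSEQ_unique)
  then have "g = shift a f" by auto
  then show ?thesis using g by simp
qed

lemma rkhs_dense_pre_space:
  assumes "f \<in> hcarrier rkhs"
  obtains \<sigma> where "range \<sigma> \<subseteq> hcarrier pre_space" "hconverges rkhs \<sigma> f"
  using rkhs_dense[OF assms] unfolding carrier_pre_space by blast

lemma shift_rkhs:
  assumes "f \<in> hcarrier rkhs"
  shows "shift a f \<in> hcarrier rkhs" "hnorm rkhs (shift a f) \<le> norm a * hnorm rkhs f"
proof -
  obtain \<sigma> where \<sigma>: "range \<sigma> \<subseteq> hcarrier pre_space" "hconverges rkhs \<sigma> f"
    using rkhs_dense_pre_space[OF assms] by blast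
  note lim = shift_hconverges[OF \<sigma>, of a]
  show "shift a f \<in> hcarrier rkhs" using F.hconverges_mem[OF lim] by blast
  show "hnorm rkhs (shift a f) \<le> norm a * hnorm rkhs f"
  proof (rule LIMSEQ_le[OF F.hconverges_hnorm[OF lim]])
    show "(\<lambda>n. norm a * hnorm rkhs (\<sigma> n)) \<longlonglongrightarrow> norm a * hnorm rkhs f"
      by (intro tendsto_mult_left F.hconverges_hnorm \<sigma>)
    show "\<exists>N. \<forall>n\<ge>N. hnorm rkhs (shift a (\<sigma> n)) \<le> norm a * hnorm rkhs (\<sigma> n)"
      using \<sigma>(1) by (auto intro!: shift_bound_pre_space)
  qed
qed

lemma shift_adjoint:
  assumes f: "f \<in> hcarrier rkhs" and g: "g \<in> hcarrier rkhs"
  shows "hinner rkhs f (shift a g) = hinner rkhs (shift (star a) f) g"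
proof -
  obtain \<sigma> where \<sigma>: "range \<sigma> \<subseteq> hcarrier pre_space" "hconverges rkhs \<sigma> f"
    using rkhs_dense_pre_space[OF f] by blast
  have "hinner rkhs (\<sigma> n) (shift a g) = hinner rkhs (shift (star a) (\<sigma> n)) g" for n
    using \<sigma>(1) by (intro shift_adjoint_pre_space g shift_rkhs) blast
  then show ?thesis
    using F.hconverges_inner_left[OF \<sigma>(2) shift_rkhs(1)[OF g], of a]
      F.hconverges_inner_left[OF shift_hconverges[OF \<sigma>] g, of "star a"] LIMSEQ_unique by simp
qed

lemma shift_bounded: "shift a \<in> bounded_operators rkhs rkhs"
  unfolding bounded_operators_def linear_between_def mem_Collect_eq
proof (intro conjI ballI allI exI funcsetI)
  fix f assume "f \<in> hcarrier rkhs"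
  then show "shift a f \<in> hcarrier rkhs" "hnorm rkhs (shift a f) \<le> norm a * hnorm rkhs f"
    by (rule shift_rkhs)+
qed (rule shift_add shift_scaleC)+

section \<open>Linearity in the algebra and vector coordinates\<close>

lemma kernel_section_add_algebra:
  assumes "(t, b, v) \<in> \<Omega>"
  shows "\<kappa> (t, b + c, v) = \<kappa> (t, b, v) + \<kappa> (t, c, v)"
proof -
  have "\<kappa> (t, b + c, v) (s, d, u) = \<kappa> (t, b, v) (s, d, u) + \<kappa> (t, c, v) (s, d, u)" for s d u
    using assms by (simp add: kernel_section_def scalar_domain_iff scalar_kernel_apply
        distrib_left K_add_algebra H.inner_add K_mem)
  then show ?thesis by (auto simp: fun_eq_iff)
qed

lemma kernel_section_scaleC_algebra:
  assumes "(t, b, v) \<in> \<Omega>"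
  shows "\<kappa> (t, z *\<^sub>C b, v) = z *\<^sub>C \<kappa> (t, b, v)"
proof -
  have "\<kappa> (t, z *\<^sub>C b, v) (s, d, u) = z * \<kappa> (t, b, v) (s, d, u)" for s d u
    using assms by (simp add: kernel_section_def scalar_domain_iff scalar_kernel_apply
        mult_scaleC_right K_scaleC_algebra H.inner_scaleC K_mem)
  then show ?thesis by (auto simp: fun_eq_iff)
qed

lemma kernel_section_add_vector:
  assumes "(t, b, v) \<in> \<Omega>" "(t, b, w) \<in> \<Omega>"
  shows "\<kappa> (t, b, v + w) = \<kappa> (t, b, v) + \<kappa> (t, b, w)"
proof -
  have "\<kappa> (t, b, v + w) (s, d, u) = \<kappa> (t, b, v) (s, d, u) + \<kappa> (t, b, w) (s, d, u)" for s d u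
    using assms by (simp add: kernel_section_def scalar_domain_iff scalar_kernel_apply
        K_add H.inner_add K_mem)
  then show ?thesis by (auto simp: fun_eq_iff)
qed

lemma kernel_section_scaleC_vector:
  assumes "(t, b, v) \<in> \<Omega>"
  shows "\<kappa> (t, b, z *\<^sub>C v) = z *\<^sub>C \<kappa> (t, b, v)"
proof -
  have "\<kappa> (t, b, z *\<^sub>C v) (s, d, u) = z * \<kappa> (t, b, v) (s, d, u)" for s d u
    using assms by (simp add: kernel_section_def scalar_domain_iff scalar_kernel_apply
        K_scaleC H.inner_scaleC K_mem)
  then show ?thesis by (auto simp: fun_eq_iff)
qed

text \<open>Fails for arbitrary functions; elements of \<open>rkhs\<close> inherit it from the
  kernel sections through the reproducing property. It is what makes \<open>shift\<close> additive
  in its algebra argument.\<close>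

lemma rkhs_add_algebra:
  assumes f: "f \<in> hcarrier rkhs"
  shows "f (t, b + c, v) = f (t, b, v) + f (t, c, v)"
proof (cases "t \<in> X \<and> v \<in> hcarrier H")
  case True
  then have w: "(t, d, v) \<in> \<Omega>" for d by (simp add: scalar_domain_iff)
  show ?thesis
    unfolding rkhs_eval[OF w f, symmetric] kernel_section_add_algebra[OF w]
    by (intro F.inner_add_left kernel_section_rkhs w f)
next
  case False
  then have "f (t, d, v) = 0" for d
    by (intro rkhs_vanishes[OF f]) (auto simp: scalar_domain_iff)
  then show ?thesis by simp
qed

text \<open>The conjugate appears because the section occupies the conjugate-linear slot of the
  inner product. The \<open>star\<close> in \<open>shift\<close> conjugates once more, so
  \<open>shift\<close> is linear in its algebra argument.\<close>

lemma rkhs_scaleC_algebra: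
  assumes f: "f \<in> hcarrier rkhs"
  shows "f (t, z *\<^sub>C b, v) = cnj z * f (t, b, v)"
proof (cases "t \<in> X \<and> v \<in> hcarrier H")
  case True
  then have w: "(t, d, v) \<in> \<Omega>" for d by (simp add: scalar_domain_iff)
  show ?thesis
    unfolding rkhs_eval[OF w f, symmetric] kernel_section_scaleC_algebra[OF w]
    by (intro F.inner_scaleC_left kernel_section_rkhs w f)
next
  case False
  then have "f (t, d, v) = 0" for d
    by (intro rkhs_vanishes[OF f]) (auto simp: scalar_domain_iff)
  then show ?thesis by simp
qed

lemma shift_add_algebra:
  assumes "f \<in> hcarrier rkhs"
  shows "shift (a + b) f = shift a f + shift b f"
  by (auto simp: shift_def fun_eq_iff star_add distrib_right rkhs_add_algebra[OF assms])

lemma shift_scaleC_algebra: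
  assumes "f \<in> hcarrier rkhs"
  shows "shift (z *\<^sub>C a) f = z *\<^sub>C shift a f"
  by (auto simp: shift_def fun_eq_iff star_scaleC mult_scaleC_left rkhs_scaleC_algebra[OF assms])

lemma star_representation_shift: "star_representation rkhs shift"
  unfolding star_representation_def
proof (intro conjI allI ballI)
  fix a f assume f: "f \<in> hcarrier rkhs"
  show "shift (star a) f = adjoint_op rkhs rkhs (shift a) f"
    using shift_adjoint[OF _ f, of _ "star a"] shift_rkhs(1)[OF f]
    by (intro adjoint_op_eqI[symmetric] cinner_space_rkhs) (auto simp: star_star)
  show "shift (a + b) f = shift a f + shift b f" for b using f by (rule shift_add_algebra)
  show "shift (z *\<^sub>C a) f = z *\<^sub>C shift a f" for z using f by (rule shift_scaleC_algebra)
  show "shift (a * b) f = shift a (shift b f)" for b by (rule shift_mult)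
qed (rule shift_bounded)

section \<open>Embeddings of H and the resulting factorization\<close>

definition embed :: "'x \<Rightarrow> 'h \<Rightarrow> 'x \<times> 'a \<times> 'h \<Rightarrow> complex" where
  "embed t u = \<kappa> (t, 1, u)"

lemma embed_mem: "t \<in> X \<Longrightarrow> u \<in> hcarrier H \<Longrightarrow> embed t u \<in> hcarrier rkhs"
  unfolding embed_def by (intro kernel_section_rkhs) (simp add: scalar_domain_iff)

lemma embed_bounded:
  assumes t: "t \<in> X"
  shows "embed t \<in> bounded_operators H rkhs"
proof -
  obtain M where "M \<ge> 0"
    and M: "\<And>b v. v \<in> hcarrier H \<Longrightarrow> hnorm rkhs (\<kappa> (t, b, v)) \<le> M * norm b * hnorm H v"
    using hnorm_kernel_section_bound[OF t] by metis
  have "embed t (u + v) = embed t u + embed t v" if "u \<in> hcarrier H" "v \<in> hcarrier H" for u v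
    unfolding embed_def using t that
    by (intro kernel_section_add_vector) (simp_all add: scalar_domain_iff)
  moreover have "embed t (c *\<^sub>C u) = c *\<^sub>C embed t u" if "u \<in> hcarrier H" for c u
    unfolding embed_def using t that
    by (intro kernel_section_scaleC_vector) (simp_all add: scalar_domain_iff)
  moreover have "\<exists>M. \<forall>u\<in>hcarrier H. hnorm rkhs (embed t u) \<le> M * hnorm H u"
    unfolding embed_def using M[of _ 1] by blast
  ultimately show ?thesis
    using embed_mem[OF t] unfolding bounded_operators_def linear_between_def by blast
qed

lemma embed_inner:
  assumes "t \<in> X" "u \<in> hcarrier H" "f \<in> hcarrier rkhs"
  shows "hinner rkhs (embed t u) f = f (t, 1, u)"
  unfolding embed_def by (rule rkhs_eval) (simp_all add: assms scalar_domain_iff)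

text \<open>By the reproducing property, pairing \<open>embed s x\<close> with
  \<open>shift a (embed t u)\<close> evaluates the section at \<open>(t, 1, u)\<close> in the point
  \<open>(s, star a, x)\<close>, which is the inner product of \<open>x\<close> with
  \<open>K s t a u\<close>.\<close>

lemma factorization_rkhs: "factorization X H K rkhs shift embed"
  unfolding factorization_def
proof (intro conjI ballI allI)
  show "hilbert_space rkhs" by (rule hilbert_space_rkhs)
  show "star_representation rkhs shift" by (rule star_representation_shift)
  show "embed t \<in> bounded_operators H rkhs" if "t \<in> X" for t using that by (rule embed_bounded)
  fix s t a u assume st: "s \<in> X" "t \<in> X" and u: "u \<in> hcarrier H"
  show "K s t a u = adjoint_op H rkhs (embed s) (shift a (embed t u))"
  proof (rule adjoint_op_eqI[OF H.cinner_space_axioms K_mem[OF st u], symmetric])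
    fix x assume x: "x \<in> hcarrier H"
    have "hinner rkhs (embed s x) (shift a (embed t u)) = shift a (embed t u) (s, 1, x)"
      by (intro embed_inner shift_rkhs embed_mem st x u)
    also have "\<dots> = hinner H x (K s t a u)"
      using st x u by (simp add: embed_def shift_apply kernel_section_def scalar_domain_iff
          scalar_kernel_apply star_star)
    finally show "hinner H x (K s t a u) = hinner rkhs (embed s x) (shift a (embed t u))" by simp
  qed
qed

end

lemma factorization_imp_positive_definite:
  "hilbert_space H \<Longrightarrow> factorization X H K L \<pi> V \<Longrightarrow> positive_definite_kernel X H K"
  by (rule kernel_factorization.positive_definite) (simp add: kernel_factorization_def)

text \<open>An existential quantifier over spaces ranges over one fixed type, so existence is
  asserted for functions on triples, while the converse and the statements on minimal factorizations
  cover arbitrary types \<open>'l\<close> and \<open>'m\<close>. Existence of \<open>F\<close> is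
  stated separately, so that the quantification over all \<open>F\<close> is not vacuous.\<close>

theorem theorem2:
  fixes X :: "'x set"
    and H :: "'h::complex_vector hspace"
    and K :: "'x \<Rightarrow> 'x \<Rightarrow> 'a::cstar_algebra \<Rightarrow> 'h \<Rightarrow> 'h"
  assumes "hilbert_space H"
    and "\<And>s t. s \<in> X \<Longrightarrow> t \<in> X \<Longrightarrow> K s t \<in> bounded_maps_into_operators H"
  shows
    "(positive_definite_kernel X H K \<longleftrightarrow>
        (\<exists>(L :: ('x \<times> 'a \<times> 'h \<Rightarrow> complex) hspace) \<pi> V. factorization X H K L \<pi> V))
     \<and> (\<forall>(L :: 'l::complex_vector hspace) \<pi> V.
          factorization X H K L \<pi> V \<longrightarrow> positive_definite_kernel X H K)
     \<and> (\<forall>(L :: 'l hspace) \<pi> V. minimal_factorization X H K L \<pi> V \<longrightarrow>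
          (\<exists>F. is_rkhs (scalar_domain X H) (scalar_kernel H K) F) \<and>
          (\<forall>F. is_rkhs (scalar_domain X H) (scalar_kernel H K) F \<longrightarrow> unitarily_isomorphic L F))
     \<and> (\<forall>(L :: 'l hspace) \<pi> V (L' :: 'm::complex_vector hspace) \<pi>' V'.
          minimal_factorization X H K L \<pi> V \<and> minimal_factorization X H K L' \<pi>' V' \<longrightarrow>
          (\<exists>W \<in> unitary_operators L L'.
             (\<forall>t\<in>X. \<forall>u\<in>hcarrier H. W (V t u) = V' t u) \<and>
             (\<forall>a. \<forall>x\<in>hcarrier L. W (\<pi> a x) = \<pi>' a (W x))))"
proof (intro conjI iffI allI impI)
  note H = assms(1)
  have construct: "pd_operator_kernel X H K" if "positive_definite_kernel X H K"
    using assms that by (simp add: pd_operator_kernel_def)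
  {
    assume "positive_definite_kernel X H K"
    then interpret pd_operator_kernel X H K by (rule construct)
    show "\<exists>(L :: ('x \<times> 'a \<times> 'h \<Rightarrow> complex) hspace) \<pi> V. factorization X H K L \<pi> V"
      using factorization_rkhs by blast
  next
    assume "\<exists>(L :: ('x \<times> 'a \<times> 'h \<Rightarrow> complex) hspace) \<pi> V. factorization X H K L \<pi> V"
    then show "positive_definite_kernel X H K"
      using factorization_imp_positive_definite[OF H] by blast
  next
    fix L :: "'l hspace" and \<pi> V
    assume "factorization X H K L \<pi> V"
    then show "positive_definite_kernel X H K"
      by (rule factorization_imp_positive_definite[OF H])
  next
    fix L :: "'l hspace" and \<pi> V
    assume L: "minimal_factorization X H K L \<pi> V"
    \<comment> \<open>Positivity recovered from the factorization is what makes the concrete space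
      \<open>rkhs\<close> available as a witness.\<close>
    then have "positive_definite_kernel X H K"
      unfolding minimal_factorization_def using factorization_imp_positive_definite[OF H] by blast
    then interpret pd_operator_kernel X H K by (rule construct)
    show "\<exists>F. is_rkhs (scalar_domain X H) (scalar_kernel H K) F"
      using is_rkhs_rkhs by blast
  next
    fix L :: "'l hspace" and \<pi> V F
    assume "minimal_factorization X H K L \<pi> V" "is_rkhs (scalar_domain X H) (scalar_kernel H K) F"
    then show "unitarily_isomorphic L F"
      using kernel_factorization.W_unitary[OF kernel_factorization_minimal[OF H]]
      unfolding unitarily_isomorphic_def by blast
  next
    fix L :: "'l hspace" and \<pi> V and L' :: "'m hspace" and \<pi>' V'
    assume *: "minimal_factorization X H K L \<pi> V \<and> minimal_factorization X H K L' \<pi>' V'"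
    \<comment> \<open>The comparison of the two factorizations passes through a common kernel space,
      and positivity guarantees that there is one.\<close>
    then have "positive_definite_kernel X H K"
      unfolding minimal_factorization_def using factorization_imp_positive_definite[OF H] by blast
    then interpret pd_operator_kernel X H K by (rule construct)
    from * obtain W where "W \<in> unitary_operators L L'"
      "\<And>t u. t \<in> X \<Longrightarrow> u \<in> hcarrier H \<Longrightarrow> W (V t u) = V' t u"
      "\<And>a x. x \<in> hcarrier L \<Longrightarrow> W (\<pi> a x) = \<pi>' a (W x)"
      using minimal_factorization_unique[OF H is_rkhs_rkhs] by blast
    then show "\<exists>W \<in> unitary_operators L L'.
        (\<forall>t\<in>X. \<forall>u\<in>hcarrier H. W (V t u) = V' t u) \<and>
        (\<forall>a. \<forall>x\<in>hcarrier L. W (\<pi> a x) = \<pi>' a (W x))"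
      by blast
  }
qed

end
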